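(* Let $q$ be a prime power, let $X_0\in\mathbb{F}_q[T]$ be fixed, let $d\geqslant 0$ be an integer and let $I=\{X_0+Y: Y\in\mathbb{F}_q[T],\ \deg Y\leqslant d\}$. For an irreducible polynomial $f\in\mathbb{F}_q[T]$ and $\lambda\in\mathbb{F}_q[T]$, let $N_\lambda(I^2)$ be the number of pairs $(a,b)\in I^2$ with $a^3\equiv\lambda b^2\pmod f$. Then for every irreducible $f\in\mathbb{F}_q[T]$ with $1\leqslant|I|\leqslant|f|^{1/9}$ and every $\lambda\in\mathbb{F}_q[T]$, $$N_\lambda(I^2)\leqslant|I|^{\frac13+o(1)}.$$
   Context: For $X\in\mathbb{F}_q[T]$, $|X|=q^{\deg X}$; $|I|$ is the number of elements of $I$. The $o(1)$ term tends to $0$ as $|I|\to\infty$.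
   Formalization: The formal theorem assumes in addition that λ is not divisible by f; for λ = 0, X_0 = 0 and deg f ≥ 9(d+1) the congruence forces a = 0 with b arbitrary, so N_λ(I²) = |I| and the stated bound fails. *)

theory Defs
  imports Complex_Main "HOL-Library.Cardinality" "HOL-Computational_Algebra.Computational_Algebra"
    "HOL-Number_Theory.Cong"
begin

text \<open>
  The field with \<open>q\<close> elements is a type \<open>'a\<close> of class \<open>{field, finite}\<close>, so that
  \<open>q = CARD('a)\<close>, and \<open>'a poly\<close> is the polynomial ring over it.
\<close>

definition poly_abs :: "'a::{field,finite} poly \<Rightarrow> real" where
  "poly_abs X = (if X = 0 then 0 else real CARD('a) ^ degree X)"

text \<open>Since \<open>degree 0 = 0\<close>, the choice \<open>Y = 0\<close> is always allowed, as under \<open>deg 0 = -\<infinity>\<close>.\<close>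

definition poly_interval :: "'a::{field,finite} poly \<Rightarrow> nat \<Rightarrow> 'a poly set" where
  "poly_interval X\<^sub>0 d = {X\<^sub>0 + Y | Y. degree Y \<le> d}"

definition num_solutions :: "'a::{field,finite} poly \<Rightarrow> 'a poly \<Rightarrow> 'a poly set \<Rightarrow> nat" where
  "num_solutions f lam I = card {(a, b). a \<in> I \<and> b \<in> I \<and> [a ^ 3 = lam * b ^ 2] (mod f)}"

text \<open>Neither \<open>card (poly_interval X\<^sub>0 d)\<close> nor \<open>num_solutions\<close> is a cardinality of an infinite set.\<close>

lemma finite_degree_le: "finite {Y :: 'a::{field,finite} poly. degree Y \<le> d}"
proof (rule finite_subset)
  show "{Y :: 'a poly. degree Y \<le> d} \<subseteq> Poly ` {xs. set xs \<subseteq> UNIV \<and> length xs \<le> Suc d}"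
  proof
    fix Y :: "'a poly" assume "Y \<in> {Y. degree Y \<le> d}"
    then have "length (coeffs Y) \<le> Suc d" by (cases "Y = 0") (auto simp: length_coeffs_degree)
    then show "Y \<in> Poly ` {xs. set xs \<subseteq> UNIV \<and> length xs \<le> Suc d}"
      by (intro image_eqI[of _ _ "coeffs Y"]) auto
  qed
  show "finite (Poly ` {xs :: 'a list. set xs \<subseteq> UNIV \<and> length xs \<le> Suc d})"
    by (intro finite_imageI finite_lists_length_le) auto
qed

lemma finite_poly_interval: "finite (poly_interval X\<^sub>0 d)"
  using finite_imageI[OF finite_degree_le, of "\<lambda>Y. X\<^sub>0 + Y" d]
  by (simp add: poly_interval_def setcompr_eq_image)

text \<open>
  For \<open>lam \<equiv> 0\<close> modulo \<open>f\<close> the congruence degenerates to \<open>a \<equiv> 0\<close>, with \<open>b\<close> arbitrary, and the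
  number of solutions can be as large as the whole interval. A bound of the form
  \<open>card I powr (1/3 + o(1))\<close> therefore needs \<open>\<not> f dvd lam\<close>.
\<close>

lemma num_solutions_degenerate:
  fixes f lam :: "'a::{field,finite} poly"
  assumes f: "irreducible f" and deg: "d < degree f" and "f dvd lam"
  shows "num_solutions f lam (poly_interval 0 d) = card (poly_interval (0 :: 'a poly) d)"
proof -
  have p: "prime_elem f" using f by (rule field_poly_irreducible_imp_prime)
  have *: "[a ^ 3 = lam * b ^ 2] (mod f) \<longleftrightarrow> a = 0" if "degree a \<le> d" for a b :: "'a poly"
  proof -
    have "lam * b ^ 2 mod f = 0" using \<open>f dvd lam\<close> by simp
    then have "[a ^ 3 = lam * b ^ 2] (mod f) \<longleftrightarrow> f dvd a ^ 3"
      by (simp add: cong_def mod_eq_0_iff_dvd)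
    also have "\<dots> \<longleftrightarrow> f dvd a" using p by (simp add: prime_elem_dvd_power_iff)
    also have "\<dots> \<longleftrightarrow> a = 0"
      using that deg dvd_imp_degree_le[of f a] by fastforce
    finally show ?thesis .
  qed
  from *[of 0] have "[0 = lam * b ^ 2] (mod f)" for b by simp
  with * have "{(a, b). a \<in> poly_interval 0 d \<and> b \<in> poly_interval 0 d \<and>
      [a ^ 3 = lam * b ^ 2] (mod f)} = {0} \<times> poly_interval 0 d"
    by (auto simp: poly_interval_def)
  then show ?thesis by (simp add: num_solutions_def card_cartesian_product_singleton)
qed

end

theory Submission
  imports Defs "HOL-Analysis.Cartesian_Space" "HOL-Real_Asymp.Real_Asymp"
begin

text \<open>
  Multiplying \<open>(X\<^sub>0 + x)\<^sup>3 - \<lambda> (X\<^sub>0 + y)\<^sup>2\<close> by a suitable \<open>t\<close> makes all coefficients so small modulo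
  \<open>f\<close> that the congruence becomes an equation \<open>\<alpha>(x) = t y\<^sup>2 + s y\<close> over \<open>\<bbbF>\<^sub>q[T]\<close> with \<open>\<alpha>\<close> a cubic;
  this is where the exponent \<open>1/9\<close> enters.  The points of degree at most \<open>d\<close> on such a curve are
  counted by the \<open>P\<close>-adic method of Bombieri--Pila and Heath-Brown.  Unless there are only
  boundedly many points, the coefficients may be taken of degree \<open>O(d)\<close>, so that every
  nonsingular point is nonsingular modulo some irreducible \<open>P\<close> of degree \<open>O(log d)\<close>.  Near a point
  nonsingular modulo \<open>P\<close> the curve is parametrized by a power series, so a counting argument gives
  a polynomial combination of the \<open>x\<^sup>i y\<^sup>j\<close>, \<open>i \<le> 2\<close>, \<open>j \<le> D\<close>, which vanishes at all points of a residue
  class modulo \<open>P\<^sup>m\<close> as soon as \<open>m deg P > d (D + 2) / (3 D + 2)\<close>.  It meets the curve in \<open>O(D)\<close>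
  points, hence the total is at most \<open>q\<close> to the power \<open>d (1/3 + O(1/D)) + O(log d)\<close>.
\<close>

subsection \<open>Polynomials of bounded degree\<close>

text \<open>Bounding coefficients instead of \<open>degree\<close> keeps 0 in the set even for
  \<open>e = 0\<close>; the set is an additive group with exactly \<open>CARD('a) ^ e\<close>
  elements.\<close>

definition polys_below :: "nat \<Rightarrow> 'a::zero poly set" where
  "polys_below e = {p. \<forall>k\<ge>e. coeff p k = 0}"

lemma polys_below_iff: "p \<in> polys_below e \<longleftrightarrow> p = 0 \<or> degree p < e"
proof
  assume p: "p \<in> polys_below e"
  then have "coeff p (degree p) = 0" if "e \<le> degree p"
    using that by (auto simp: polys_below_def)
  then show "p = 0 \<or> degree p < e" by (metis leading_coeff_0_iff not_less)
next
  assume "p = 0 \<or> degree p < e"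
  then show "p \<in> polys_below e" by (auto simp: polys_below_def coeff_eq_0)
qed

lemma polys_below_Suc_iff: "p \<in> polys_below (Suc d) \<longleftrightarrow> degree p \<le> d"
  by (auto simp: polys_below_iff)

lemma polys_below_0 [simp]: "0 \<in> polys_below e"
  by (simp add: polys_below_def)

lemma polys_below_mono: "p \<in> polys_below e \<Longrightarrow> e \<le> e' \<Longrightarrow> p \<in> polys_below e'"
  by (auto simp: polys_below_def)

lemma polys_below_add: "p \<in> polys_below e \<Longrightarrow> r \<in> polys_below e \<Longrightarrow> p + r \<in> polys_below e"
  for p r :: "'a::comm_monoid_add poly"
  by (auto simp: polys_below_def)

lemma polys_below_diff: "p \<in> polys_below e \<Longrightarrow> r \<in> polys_below e \<Longrightarrow> p - r \<in> polys_below e"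
  for p r :: "'a::ab_group_add poly"
  by (auto simp: polys_below_def)

lemma polys_below_sum:
  "(\<And>i. i \<in> J \<Longrightarrow> p i \<in> polys_below e) \<Longrightarrow> (\<Sum>i\<in>J. p i) \<in> polys_below e"
  for p :: "'i \<Rightarrow> 'a::comm_monoid_add poly"
  by (induction J rule: infinite_finite_induct) (auto intro: polys_below_add)

lemma polys_below_mult:
  assumes "p \<in> polys_below e" "degree r \<le> d"
  shows "p * r \<in> polys_below (e + d)"
proof (cases "p = 0")
  case False
  then have "degree (p * r) < e + d"
    using assms degree_mult_le[of p r] by (auto simp: polys_below_iff)
  then show ?thesis by (simp add: polys_below_iff)
qed simp

text \<open>The device that turns congruences between small quantities into equations.\<close>

lemma dvd_polys_below_imp_0:
  fixes p :: "'a::field poly"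
  assumes "M dvd p" "p \<in> polys_below (degree M)"
  shows "p = 0"
  using assms dvd_imp_degree_le[of M p] by (force simp: polys_below_iff)

lemma polys_below_Suc:
  "polys_below (Suc e) = (\<lambda>(a, p). pCons a p) ` (UNIV \<times> polys_below e)"
proof (intro equalityI subsetI)
  fix p :: "'a poly" assume p: "p \<in> polys_below (Suc e)"
  obtain a r where pr: "p = pCons a r" by (cases p)
  have "coeff r k = 0" if "k \<ge> e" for k
    using p that unfolding pr polys_below_def by (auto dest!: spec[of _ "Suc k"])
  then show "p \<in> (\<lambda>(a, p). pCons a p) ` (UNIV \<times> polys_below e)"
    unfolding pr polys_below_def by auto
qed (auto simp: polys_below_def coeff_pCons split: nat.splits)

lemma finite_polys_below [simp]: "finite (polys_below e :: 'a::{zero,finite} poly set)"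
  and card_polys_below [simp]: "card (polys_below e :: 'a::{zero,finite} poly set) = CARD('a) ^ e"
proof (induction e)
  case 0
  have "polys_below 0 = {0 :: 'a poly}" by (auto simp: polys_below_def poly_eq_iff)
  then show "finite (polys_below 0 :: 'a poly set)"
    and "card (polys_below 0 :: 'a poly set) = CARD('a) ^ 0" by auto
next
  case (Suc e)
  have "inj_on (\<lambda>(a, p). pCons a p) (UNIV \<times> polys_below e :: ('a \<times> 'a poly) set)"
    by (auto simp: inj_on_def)
  then show "finite (polys_below (Suc e) :: 'a poly set)"
    and "card (polys_below (Suc e) :: 'a poly set) = CARD('a) ^ Suc e"
    using Suc by (simp_all add: polys_below_Suc card_image card_cartesian_product)
qed

lemma card_poly_interval:
  "card (poly_interval X\<^sub>0 d :: 'a::{field,finite} poly set) = CARD('a) ^ Suc d"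
proof -
  have "poly_interval X\<^sub>0 d = (+) X\<^sub>0 ` polys_below (Suc d)"
    by (auto simp: poly_interval_def polys_below_Suc_iff)
  then show ?thesis by (simp add: card_image)
qed

text \<open>Pigeonhole in the style of Thue and Siegel: there are more admissible vectors than
  vectors of residues, and the difference of two vectors with equal residues still obeys the degree
  bounds, since \<open>polys_below\<close> is closed under subtraction.\<close>

lemma small_solution_congruences:
  fixes m :: "'k \<Rightarrow> 'i \<Rightarrow> 'a::{field,finite} poly"
  assumes fin: "finite J" "finite L"
    and M: "\<And>k. k \<in> L \<Longrightarrow> M k \<noteq> 0"
    and less: "(\<Sum>k\<in>L. degree (M k)) < (\<Sum>i\<in>J. e i)"
  shows "\<exists>c. (\<forall>i\<in>J. c i \<in> polys_below (e i)) \<and> (\<exists>i\<in>J. c i \<noteq> 0) \<and>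
    (\<forall>k\<in>L. M k dvd (\<Sum>i\<in>J. m k i * c i))"
proof -
  define U where "U = Pi\<^sub>E J (\<lambda>i. polys_below (e i) :: 'a poly set)"
  define \<Phi> where "\<Phi> c = restrict (\<lambda>k. (\<Sum>i\<in>J. m k i * c i) mod M k) L" for c
  have "p mod M k \<in> polys_below (degree (M k))" if "k \<in> L" for p k
    using degree_mod_less[OF M[OF that], of p] by (auto simp: polys_below_iff)
  then have sub: "\<Phi> ` U \<subseteq> Pi\<^sub>E L (\<lambda>k. polys_below (degree (M k)))"
    unfolding \<Phi>_def by auto
  have "2 \<le> CARD('a)"
    using card_mono[of UNIV "{0, 1::'a}"] by simp
  have "card (\<Phi> ` U) \<le> card (Pi\<^sub>E L (\<lambda>k. polys_below (degree (M k)) :: 'a poly set))"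
    using fin by (intro card_mono finite_PiE sub) auto
  also have "\<dots> = CARD('a) ^ (\<Sum>k\<in>L. degree (M k))"
    using fin by (simp add: card_PiE power_sum)
  also have "\<dots> < CARD('a) ^ (\<Sum>i\<in>J. e i)"
    using less \<open>2 \<le> CARD('a)\<close> by (intro power_strict_increasing) auto
  also have "\<dots> = card U"
    using fin by (simp add: U_def card_PiE power_sum)
  finally have "\<not> inj_on \<Phi> U" using pigeonhole by blast
  then obtain c1 c2 where c: "c1 \<in> U" "c2 \<in> U" "c1 \<noteq> c2" "\<Phi> c1 = \<Phi> c2"
    by (auto simp: inj_on_def)
  show ?thesis
  proof (intro exI[of _ "\<lambda>i. c1 i - c2 i"] conjI ballI)
    show "c1 i - c2 i \<in> polys_below (e i)" if "i \<in> J" for i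
      using c that by (auto simp: U_def intro!: polys_below_diff)
    show "\<exists>i\<in>J. c1 i - c2 i \<noteq> 0"
    proof (rule ccontr)
      assume "\<not> (\<exists>i\<in>J. c1 i - c2 i \<noteq> 0)"
      then have "c1 = c2" using c unfolding U_def by (intro PiE_ext) auto
      with c show False by simp
    qed
    show "M k dvd (\<Sum>i\<in>J. m k i * (c1 i - c2 i))" if "k \<in> L" for k
    proof -
      have "(\<Sum>i\<in>J. m k i * c1 i) mod M k = (\<Sum>i\<in>J. m k i * c2 i) mod M k"
        using fun_cong[OF c(4), of k] that by (simp add: \<Phi>_def)
      then have "M k dvd (\<Sum>i\<in>J. m k i * c1 i) - (\<Sum>i\<in>J. m k i * c2 i)"
        by (simp add: mod_eq_dvd_iff)
      then show ?thesis by (simp add: right_diff_distrib sum_subtractf)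
    qed
  qed
qed

subsection \<open>Intersecting the cubic with another curve\<close>

lemma coeff_mult_at_degree_bounds:
  fixes p q :: "'b::comm_semiring_1 poly"
  assumes "\<And>k. k > s \<Longrightarrow> coeff p k = 0" "\<And>k. k > t \<Longrightarrow> coeff q k = 0"
  shows "coeff (p * q) (s + t) = coeff p s * coeff q t"
proof -
  have "coeff (p * q) (s + t) = (\<Sum>i\<le>s + t. coeff p i * coeff q (s + t - i))"
    by (rule coeff_mult)
  also have "\<dots> = (\<Sum>i\<in>{s}. coeff p i * coeff q (s + t - i))"
  proof (rule sum.mono_neutral_right)
    show "\<forall>i\<in>{..s + t} - {s}. coeff p i * coeff q (s + t - i) = 0"
    proof
      fix i assume "i \<in> {..s + t} - {s}"
      then consider "i > s" | "s + t - i > t" by force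
      then show "coeff p i * coeff q (s + t - i) = 0" by cases (simp_all add: assms)
    qed
  qed auto
  finally show ?thesis by simp
qed

text \<open>On the curve \<open>t y\<^sup>2 + s y = \<alpha>(x)\<close>, \<open>t\<^sup>j y\<^sup>j = a(x) + b(x) y\<close> for \<open>(a, b) = ypow \<alpha> s t j\<close>.\<close>

primrec ypow :: "'b::comm_ring_1 poly \<Rightarrow> 'b \<Rightarrow> 'b \<Rightarrow> nat \<Rightarrow> 'b poly \<times> 'b poly" where
  "ypow \<alpha> s t 0 = (1, 0)"
| "ypow \<alpha> s t (Suc j) =
    (snd (ypow \<alpha> s t j) * \<alpha>, smult t (fst (ypow \<alpha> s t j)) - smult s (snd (ypow \<alpha> s t j)))"

lemma poly_ypow:
  assumes "t * y ^ 2 + s * y = poly \<alpha> x"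
  shows "t ^ j * y ^ j = poly (fst (ypow \<alpha> s t j)) x + poly (snd (ypow \<alpha> s t j)) x * y"
proof (induction j)
  case (Suc j)
  let ?a = "poly (fst (ypow \<alpha> s t j)) x" and ?b = "poly (snd (ypow \<alpha> s t j)) x"
  have "t ^ Suc j * y ^ Suc j = t * y * (t ^ j * y ^ j)" by simp
  also have "\<dots> = t * ?a * y + ?b * (t * y ^ 2)"
    unfolding Suc by (simp add: algebra_simps power2_eq_square)
  also have "t * y ^ 2 = poly \<alpha> x - s * y" using assms by (simp add: algebra_simps)
  finally show ?case by (simp add: algebra_simps)
qed simp

text \<open>Give \<open>x\<close> weight 2, \<open>y\<close> weight 3 and constants weight 0. As
  \<alpha> has weight at most 6, rewriting \<open>t * y ^ 2\<close> does not raise the weight, so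
  both parts of \<open>t ^ j * y ^ j\<close> have weight at most \<open>3 * j\<close>.\<close>

lemma coeff_ypow_eq_0:
  assumes "degree \<alpha> \<le> 3"
  shows "2 * k > 3 * j \<Longrightarrow> coeff (fst (ypow \<alpha> s t j)) k = 0"
    and "2 * k + 3 > 3 * j \<Longrightarrow> coeff (snd (ypow \<alpha> s t j)) k = 0"
proof (induction j arbitrary: k)
  case (Suc j)
  {
    case 1
    have "coeff (snd (ypow \<alpha> s t j)) i * coeff \<alpha> (k - i) = 0" if "i \<le> k" for i
    proof (cases "2 * i + 3 > 3 * j")
      case False
      then have "k - i > 3" using 1 that unfolding mult_Suc_right by linarith
      then show ?thesis using assms by (simp add: coeff_eq_0)
    qed (simp add: Suc)
    then show ?case by (simp add: coeff_mult)
  next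
    case 2
    then show ?case using Suc by simp
  }
qed (auto simp: coeff_eq_0)

text \<open>The weight \<open>3 * j\<close> is attained, in the first component for even
  \<open>j\<close> and in the second for odd \<open>j\<close>: the recursion multiplies the top
  coefficient alternately by \<open>t\<close> and by \<open>coeff \<alpha> 3\<close>.\<close>

lemma coeff_ypow_neq_0:
  fixes \<alpha> :: "'b::idom poly"
  assumes "degree \<alpha> = 3" "t \<noteq> 0"
  shows "2 * k = 3 * j \<Longrightarrow> coeff (fst (ypow \<alpha> s t j)) k \<noteq> 0"
    and "2 * k + 3 = 3 * j \<Longrightarrow> coeff (snd (ypow \<alpha> s t j)) k \<noteq> 0"
proof (induction j arbitrary: k)
  case (Suc j)
  {
    case 1
    then have k: "k = (k - 3) + 3" "2 * (k - 3) + 3 = 3 * j" by presburger+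
    have "coeff (snd (ypow \<alpha> s t j) * \<alpha>) ((k - 3) + 3) =
        coeff (snd (ypow \<alpha> s t j)) (k - 3) * coeff \<alpha> 3"
      using k assms by (intro coeff_mult_at_degree_bounds coeff_ypow_eq_0) (auto simp: coeff_eq_0)
    moreover have "coeff \<alpha> 3 \<noteq> 0" using assms(1) by (metis leading_coeff_0_iff degree_0 zero_neq_numeral)
    ultimately show ?case using Suc(2)[of "k - 3"] k by simp
  next
    case 2
    then have "2 * k = 3 * j" by simp
    then show ?case using Suc(1)[of k] assms coeff_ypow_eq_0(2)[of \<alpha> j k s t] by simp
  }
qed auto

text \<open>For \<open>y\<close> with \<open>t * y ^ 2 + s * y = \<alpha>\<close> this is
  \<open>t\<close> times the norm of \<open>a + b * y\<close>. If \<open>a\<close> and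
  \<open>b\<close> are nonzero, the first term has even degree, the last odd degree, and the mixed
  term lies below the larger of the two.\<close>

lemma norm_form_neq_0:
  fixes \<alpha> a b :: "'b::idom poly"
  assumes \<alpha>: "degree \<alpha> = 3" and t: "t \<noteq> 0" and ab: "a \<noteq> 0 \<or> b \<noteq> 0"
  shows "smult t (a ^ 2) - smult s (a * b) - \<alpha> * b ^ 2 \<noteq> 0"
proof (cases "a = 0 \<or> b = 0")
  case True
  moreover have "\<alpha> \<noteq> 0" using \<alpha> by auto
  ultimately show ?thesis using t ab by auto
next
  case False
  have deg: "degree (smult t (a ^ 2)) = 2 * degree a"
    "degree (smult s (a * b)) \<le> degree a + degree b"
    "degree (\<alpha> * b ^ 2) = 2 * degree b + 3"
    using False \<alpha> t by (auto simp: degree_mult_eq degree_power_eq)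
      (metis degree_mult_eq degree_power_eq zero_neq_numeral degree_0 power_not_zero mult.commute add.commute)
  have "2 * degree a \<noteq> 2 * degree b + 3" by presburger
  then consider "2 * degree a > 2 * degree b + 3" | "2 * degree a < 2 * degree b + 3" by linarith
  then show ?thesis
  proof cases
    case 1
    then have "degree (smult s (a * b) + \<alpha> * b ^ 2) < degree (smult t (a ^ 2))"
      using deg by (intro degree_add_less) auto
    then have "smult t (a ^ 2) \<noteq> smult s (a * b) + \<alpha> * b ^ 2" by fastforce
    then show ?thesis by (simp add: algebra_simps)
  next
    case 2
    then have "degree (smult t (a ^ 2) - smult s (a * b)) < degree (\<alpha> * b ^ 2)"
      using deg by (intro degree_diff_less) auto
    then have "smult t (a ^ 2) - smult s (a * b) \<noteq> \<alpha> * b ^ 2" by fastforce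
    then show ?thesis by simp
  qed
qed

text \<open>Above each root of \<open>R\<close> lie at most two values of \<open>y\<close>, because
  \<open>t \<noteq> 0\<close> keeps the equation for \<open>y\<close> quadratic.\<close>

lemma card_curve_points_le_roots:
  fixes \<alpha> R :: "'b::idom poly"
  assumes "R \<noteq> 0" "t \<noteq> 0"
    and T: "\<And>x y. (x, y) \<in> T \<Longrightarrow> t * y ^ 2 + s * y = poly \<alpha> x"
      "\<And>x y. (x, y) \<in> T \<Longrightarrow> poly R x = 0"
  shows "finite T \<and> card T \<le> 2 * degree R"
proof -
  define Y where "Y x = {y. poly [:- poly \<alpha> x, s, t:] y = 0}" for x
  have Y: "finite (Y x)" "card (Y x) \<le> 2" for x
  proof -
    have nz: "[:- poly \<alpha> x, s, t:] \<noteq> 0" using assms by simp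
    show "finite (Y x)" unfolding Y_def by (rule poly_roots_finite[OF nz])
    show "card (Y x) \<le> 2"
      using card_poly_roots_bound[OF nz] assms by (simp add: Y_def)
  qed
  have fin: "finite {x. poly R x = 0}" by (rule poly_roots_finite) fact
  have sub: "T \<subseteq> Sigma {x. poly R x = 0} Y"
    using T by (auto simp: Y_def algebra_simps power2_eq_square)
  have "card (Sigma {x. poly R x = 0} Y) = (\<Sum>x\<in>{x. poly R x = 0}. card (Y x))"
    using fin Y by simp
  also have "\<dots> \<le> (\<Sum>x\<in>{x. poly R x = 0}. 2)" by (intro sum_mono Y)
  also have "\<dots> \<le> 2 * degree R" using card_poly_roots_bound[OF assms(1)] by simp
  finally show ?thesis
    using sub fin Y card_mono[OF _ sub] by (auto intro: finite_subset[OF sub])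
qed

text \<open>
  With weights 2 and 3 for \<open>x\<close> and \<open>y\<close> the monomials \<open>x\<^sup>i y\<^sup>j\<close>, \<open>i \<le> 2\<close>, have distinct weights
  \<open>2 i + 3 j\<close>, so no nontrivial combination of them vanishes identically on the curve.
\<close>

lemma card_curve_points_le:
  fixes \<alpha> :: "'b::idom poly" and c :: "nat \<Rightarrow> nat \<Rightarrow> 'b"
  assumes \<alpha>: "degree \<alpha> = 3" and t: "t \<noteq> 0"
    and c: "\<exists>i\<le>2. \<exists>j\<le>D. c i j \<noteq> 0"
    and curve: "\<And>x y. (x, y) \<in> T \<Longrightarrow> t * y ^ 2 + s * y = poly \<alpha> x"
    and zero: "\<And>x y. (x, y) \<in> T \<Longrightarrow> (\<Sum>(i, j)\<in>{..2} \<times> {..D}. c i j * (x ^ i * y ^ j)) = 0"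
  shows "finite T \<and> card T \<le> 12 * D + 14"
proof -
  define J where "J = {..2::nat} \<times> {..D}"
  \<comment> \<open>Multiplying the relation by \<open>t ^ D\<close> leaves
    \<open>t ^ (D - j)\<close> beside each \<open>t ^ j * y ^ j\<close>, which \<open>ypow\<close>
    rewrites; \<open>tm fst i j\<close> and \<open>tm snd i j\<close> are the resulting
    contributions to \<open>a\<close> and \<open>b\<close> in \<open>a + b * y\<close>.\<close>
  define tm where "tm pr i j = smult (c i j * t ^ (D - j)) (pr (ypow \<alpha> s t j) * monom 1 i)" for pr :: "'b poly \<times> 'b poly \<Rightarrow> 'b poly" and i j
  define a where "a = (\<Sum>(i, j)\<in>J. tm fst i j)"
  define b where "b = (\<Sum>(i, j)\<in>J. tm snd i j)"
  have finJ: "finite J" by (simp add: J_def)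
  have coeff_tm: "coeff (tm pr i j) k = c i j * t ^ (D - j) *
      (if k < i then 0 else coeff (pr (ypow \<alpha> s t j)) (k - i))" for pr i j k
    unfolding tm_def by (simp add: coeff_monom_mult mult.commute[of _ "monom 1 i"])

  have "\<exists>ij\<in>{ij\<in>J. c (fst ij) (snd ij) \<noteq> 0}. \<forall>ij'\<in>{ij\<in>J. c (fst ij) (snd ij) \<noteq> 0}.
      2 * fst ij' + 3 * snd ij' \<le> 2 * fst ij + 3 * snd ij"
  proof -
    let ?X = "{ij\<in>J. c (fst ij) (snd ij) \<noteq> 0}" and ?w = "\<lambda>ij. 2 * fst ij + 3 * snd ij :: nat"
    have "finite ?X" "?X \<noteq> {}" using finJ c by (auto simp: J_def)
    then have "Max (?w ` ?X) \<in> ?w ` ?X" "\<And>z. z \<in> ?X \<Longrightarrow> ?w z \<le> Max (?w ` ?X)"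
      by (auto intro: Max_in)
    then show ?thesis by force
  qed
  then obtain i0 j0 where ij0: "(i0, j0) \<in> J" "c i0 j0 \<noteq> 0"
    and max: "\<And>i j. (i, j) \<in> J \<Longrightarrow> c i j \<noteq> 0 \<Longrightarrow> 2 * i + 3 * j \<le> 2 * i0 + 3 * j0"
    by fastforce
  have less: "2 * i + 3 * j < 2 * i0 + 3 * j0"
    if "(i, j) \<in> J" "c i j \<noteq> 0" "(i, j) \<noteq> (i0, j0)" for i j
  proof -
    have "2 * i + 3 * j \<noteq> 2 * i0 + 3 * j0"
    proof
      assume eq: "2 * i + 3 * j = 2 * i0 + 3 * j0"
      have "i \<le> 2" "i0 \<le> 2" using that ij0 by (auto simp: J_def)
      \<comment> \<open>\<open>2 * i\<close> and \<open>2 * i0\<close> agree modulo 3, and both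
        indices are at most 2.\<close>
      with eq have "i = i0" by presburger
      with eq that show False by simp
    qed
    with max[OF that(1,2)] show ?thesis by simp
  qed
  have single: "coeff (\<Sum>(i, j)\<in>J. tm pr i j) k = coeff (tm pr i0 j0) k"
    if "\<And>i j. (i, j) \<in> J \<Longrightarrow> c i j \<noteq> 0 \<Longrightarrow> (i, j) \<noteq> (i0, j0) \<Longrightarrow> coeff (tm pr i j) k = 0"
    for pr k
  proof -
    have "coeff (\<Sum>(i, j)\<in>J. tm pr i j) k = (\<Sum>(i, j)\<in>J. coeff (tm pr i j) k)"
      by (simp add: coeff_sum case_prod_unfold)
    also have "\<dots> = (\<Sum>(i, j)\<in>{(i0, j0)}. coeff (tm pr i j) k)"
    proof (rule sum.mono_neutral_right[OF finJ])
      show "\<forall>ij\<in>J - {(i0, j0)}. (case ij of (i, j) \<Rightarrow> coeff (tm pr i j) k) = 0"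
      proof
        fix ij assume "ij \<in> J - {(i0, j0)}"
        moreover obtain i j where ij: "ij = (i, j)" by fastforce
        ultimately have *: "(i, j) \<in> J" "(i, j) \<noteq> (i0, j0)" by auto
        have "coeff (tm pr i j) k = 0"
        proof (cases "c i j = 0")
          case True
          then show ?thesis by (simp add: coeff_tm)
        next
          case False
          then show ?thesis using * that by blast
        qed
        then show "(case ij of (i, j) \<Rightarrow> coeff (tm pr i j) k) = 0" by (simp add: ij)
      qed
    qed (use ij0 in auto)
    finally show ?thesis by simp
  qed

  \<comment> \<open>The parity of \<open>j0\<close> decides whether the top weight appears in
    \<open>a\<close> or in \<open>b\<close>; the other monomials have smaller weight and cannot
    cancel it.\<close>
  have ab: "a \<noteq> 0 \<or> b \<noteq> 0"
  proof (cases "even j0")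
    case True
    then obtain l where l: "j0 = 2 * l" by auto
    have "coeff a (i0 + 3 * l) = coeff (tm fst i0 j0) (i0 + 3 * l)"
      unfolding a_def
    proof (rule single)
      fix i j assume "(i, j) \<in> J" "c i j \<noteq> 0" "(i, j) \<noteq> (i0, j0)"
      from less[OF this] l have "2 * (i0 + 3 * l - i) > 3 * j" by linarith
      then show "coeff (tm fst i j) (i0 + 3 * l) = 0"
        using \<alpha> by (simp add: coeff_tm coeff_ypow_eq_0)
    qed
    also have "\<dots> \<noteq> 0"
      using \<alpha> t ij0 l coeff_ypow_neq_0(1)[OF \<alpha> t, of "3 * l" j0 s] by (simp add: coeff_tm)
    finally show ?thesis by auto
  next
    case False
    then obtain l where l: "j0 = 2 * l + 1" by (auto elim: oddE)
    have "coeff b (i0 + 3 * l) = coeff (tm snd i0 j0) (i0 + 3 * l)"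
      unfolding b_def
    proof (rule single)
      fix i j assume "(i, j) \<in> J" "c i j \<noteq> 0" "(i, j) \<noteq> (i0, j0)"
      from less[OF this] l have "i0 + 3 * l < i \<or> 2 * (i0 + 3 * l - i) + 3 > 3 * j" by linarith
      then show "coeff (tm snd i j) (i0 + 3 * l) = 0"
        using \<alpha> by (auto simp: coeff_tm coeff_ypow_eq_0)
    qed
    also have "\<dots> \<noteq> 0"
      using \<alpha> t ij0 l coeff_ypow_neq_0(2)[OF \<alpha> t, of "3 * l" j0 s] by (simp add: coeff_tm)
    finally show ?thesis by auto
  qed

  have deg_tm: "degree (tm pr i j) \<le> 3 * D + 2" if "(i, j) \<in> J" "pr = fst \<or> pr = snd" for pr i j
  proof (rule degree_le, intro allI impI)
    fix k assume "k > 3 * D + 2"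
    with that(1) have k: "k - i > 3 * j" by (auto simp: J_def)
    then have "2 * (k - i) > 3 * j" "2 * (k - i) + 3 > 3 * j" by linarith+
    with that(2) show "coeff (tm pr i j) k = 0"
      using \<alpha> by (auto simp: coeff_tm coeff_ypow_eq_0)
  qed
  have deg: "degree a \<le> 3 * D + 2" "degree b \<le> 3 * D + 2"
    unfolding a_def b_def using deg_tm by (auto intro!: degree_sum_le finJ)

  define R where "R = smult t (a ^ 2) - smult s (a * b) - \<alpha> * b ^ 2"
  have R0: "R \<noteq> 0" unfolding R_def by (rule norm_form_neq_0[OF \<alpha> t ab])
  have "degree R \<le> 6 * D + 7"
    unfolding R_def
  proof (intro degree_diff_le)
    show "degree (smult t (a ^ 2)) \<le> 6 * D + 7"
      using degree_smult_le[of t "a ^ 2"] degree_power_le[of a 2] deg by linarith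
    show "degree (smult s (a * b)) \<le> 6 * D + 7"
      using degree_smult_le[of s "a * b"] degree_mult_le[of a b] deg by linarith
    show "degree (\<alpha> * b ^ 2) \<le> 6 * D + 7"
      using degree_mult_le[of \<alpha> "b ^ 2"] degree_power_le[of b 2] deg \<alpha> by linarith
  qed
  moreover have "poly R x = 0" if xy: "(x, y) \<in> T" for x y
  proof -
    have "poly a x + poly b x * y = (\<Sum>(i, j)\<in>J. poly (tm fst i j) x + poly (tm snd i j) x * y)"
      by (simp add: a_def b_def poly_sum case_prod_unfold sum.distrib sum_distrib_right)
    also have "\<dots> = (\<Sum>(i, j)\<in>J. t ^ D * (c i j * (x ^ i * y ^ j)))"
    proof (rule sum.cong[OF refl], clarify)
      fix i j assume "(i, j) \<in> J"
      then have "t ^ D = t ^ (D - j) * t ^ j" by (simp add: J_def flip: power_add)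
      then have "t ^ D * (c i j * (x ^ i * y ^ j)) = c i j * t ^ (D - j) * x ^ i * (t ^ j * y ^ j)"
        by (simp add: algebra_simps)
      then show "poly (tm fst i j) x + poly (tm snd i j) x * y = t ^ D * (c i j * (x ^ i * y ^ j))"
        unfolding poly_ypow[OF curve[OF xy]] by (simp add: tm_def poly_monom algebra_simps)
    qed
    also have "\<dots> = t ^ D * (\<Sum>(i, j)\<in>J. c i j * (x ^ i * y ^ j))"
      by (simp add: sum_distrib_left case_prod_unfold)
    finally have *: "poly a x + poly b x * y = 0" using zero[OF xy] by (simp add: J_def)
    \<comment> \<open>The second factor is \<open>t\<close> times the conjugate of
      \<open>a + b * y\<close>, so a zero of \<open>a + b * y\<close> on the curve is a zero of the
      norm.\<close>
    have "poly R x = (poly a x + poly b x * y) * (t * poly a x - s * poly b x - t * poly b x * y)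
        + (poly b x) ^ 2 * (t * y ^ 2 + s * y - poly \<alpha> x)"
      by (simp add: R_def algebra_simps power2_eq_square)
    with * curve[OF xy] show ?thesis by simp
  qed
  ultimately show ?thesis
    using card_curve_points_le_roots[OF R0 t, of T s \<alpha>] curve by fastforce
qed

subsection \<open>From the congruence to a cubic with small coefficients\<close>

text \<open>
  The unknowns are the coefficients at \<open>x\<^sup>3, x\<^sup>2, x, y\<^sup>2, y\<close>, in this order; the \<open>k\<close>-th one is required
  to be congruent to \<open>m k\<close> times the first, and \<open>w k\<close> is the degree of its monomial.
\<close>

lemma lattice_curve:
  fixes f lam X0 :: "'a::{field,finite} poly"
  assumes f: "irreducible f" and lam: "\<not> f dvd lam" and d: "9 * d < degree f"
  obtains \<alpha> s t where "degree \<alpha> = 3" "t \<noteq> 0"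
    "\<And>x y. \<lbrakk>degree x \<le> d; degree y \<le> d; [(X0 + x) ^ 3 = lam * (X0 + y) ^ 2] (mod f)\<rbrakk> \<Longrightarrow>
      t * y ^ 2 + s * y = poly \<alpha> x"
proof -
  have pf: "prime_elem f" using f by (rule field_poly_irreducible_imp_prime)
  have f0: "f \<noteq> 0" using d by auto
  define m :: "nat \<Rightarrow> 'a poly" where
    "m k = [1, 3 * X0, 3 * X0 ^ 2, lam, 2 * lam * X0] ! k" for k
  define w :: "nat \<Rightarrow> nat" where "w k = [3, 2, 1, 2, 1] ! k" for k
  have w: "w k \<le> 3" if "k < 5" for k
    using that by (auto simp: w_def less_Suc_eq numeral_eq_Suc)
  \<comment> \<open>The unknowns have \<open>5 * degree f - 9 * d\<close> coefficients, with 9 = 3 +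
    2 + 1 + 2 + 1, against \<open>4 * degree f\<close> conditions.\<close>
  have "(\<Sum>k\<in>{1..<5::nat}. degree f) < (\<Sum>i<5::nat. degree f - w i * d)"
    using d by (simp add: w_def eval_nat_numeral)
  then have "\<exists>c. (\<forall>i\<in>{..<5::nat}. c i \<in> polys_below (degree f - w i * d)) \<and> (\<exists>i\<in>{..<5}. c i \<noteq> 0) \<and>
      (\<forall>k\<in>{1..<5::nat}. f dvd (\<Sum>i<5. (if i = k then 1 else if i = 0 then - m k else 0) * c i))"
    using f0 by (intro small_solution_congruences) auto
  then obtain c where c: "\<And>i. i < 5 \<Longrightarrow> c i \<in> polys_below (degree f - w i * d)"
      "\<exists>i<5. c i \<noteq> 0"
      and fdvd: "\<And>k. k \<in> {1..<5} \<Longrightarrow>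
        f dvd (\<Sum>i<5. (if i = k then 1 else if i = 0 then - m k else 0) * c i)"
    by (meson lessThan_iff)
  have fdvd': "f dvd c k - m k * c 0" if "k \<in> {1..<5}" for k
  proof -
    have "(\<Sum>i<5. (if i = k then 1 else if i = 0 then - m k else 0) * c i) =
        (\<Sum>i\<in>{0, k}. (if i = k then 1 else if i = 0 then - m k else 0) * c i)"
      using that by (intro sum.mono_neutral_right) auto
    also have "\<dots> = c k - m k * c 0" using that by simp
    finally show ?thesis using fdvd[OF that] by simp
  qed
  have small: "c k = 0" if "k < 5" "f dvd c k" for k
    using dvd_polys_below_imp_0[OF that(2)] polys_below_mono[OF c(1)[OF that(1)]] by simp
  have c0: "c 0 \<noteq> 0"
  proof
    assume "c 0 = 0"
    then have "c k = 0" if "k < 5" for k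
      using that fdvd'[of k] small[of k] by (cases "k = 0") auto
    with c(2) show False by blast
  qed
  then have nd0: "\<not> f dvd c 0" using small[of 0] by auto
  \<comment> \<open>The term in \<open>y ^ 2\<close> survives because the prime element
    \<open>f\<close> divides neither \<open>lam\<close> nor \<open>c 0\<close>.\<close>
  have c3: "c 3 \<noteq> 0"
  proof
    assume "c 3 = 0"
    then have "f dvd lam * c 0" using fdvd'[of 3] by (simp add: m_def eval_nat_numeral)
    then show False using pf lam nd0 by (simp add: prime_elem_dvd_mult_iff)
  qed
  \<comment> \<open>The constant term needs no unknown of its own: any residue modulo
    \<open>f\<close>, once reduced, is small enough.\<close>
  define e where "e = ((X0 ^ 3 - lam * X0 ^ 2) * c 0) mod f"
  have e: "e \<in> polys_below (degree f)"
    using degree_mod_less[OF f0, of "(X0 ^ 3 - lam * X0 ^ 2) * c 0"] by (auto simp: e_def polys_below_iff)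
  have fe: "f dvd e - (X0 ^ 3 - lam * X0 ^ 2) * c 0"
    unfolding e_def by (simp add: mod_eq_dvd_iff[symmetric])
  show ?thesis
  proof (rule that[of "[:e, c 2, c 1, c 0:]" "c 3" "c 4"])
    show "degree [:e, c 2, c 1, c 0:] = 3" using c0 by simp
    show "c 3 \<noteq> 0" by (rule c3)
    fix x y assume xy: "degree x \<le> d" "degree y \<le> d" "[(X0 + x) ^ 3 = lam * (X0 + y) ^ 2] (mod f)"
    \<comment> \<open>\<open>G\<close> is congruent to \<open>c 0\<close> times the original
      expression, hence to 0, and all its terms have degree below that of \<open>f\<close>.\<close>
    define G where "G = c 0 * x ^ 3 + c 1 * x ^ 2 + c 2 * x + e - (c 3 * y ^ 2 + c 4 * y)"
    have mon: "c i * r \<in> polys_below (degree f)" if "i < 5" "degree r \<le> w i * d" for i r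
    proof -
      have "w i * d \<le> degree f" using d mult_right_mono[OF w[OF that(1)], of d] by linarith
      then show ?thesis using polys_below_mult[OF c(1)[OF that(1)] that(2)] by simp
    qed
    have "G \<in> polys_below (degree f)"
      unfolding G_def
      using xy degree_power_le[of x 2] degree_power_le[of x 3] degree_power_le[of y 2]
      by (intro polys_below_add polys_below_diff mon e)
        (auto simp: w_def eval_nat_numeral intro: order_trans)
    moreover have "f dvd G"
    proof -
      have "f dvd c 0 * ((X0 + x) ^ 3 - lam * (X0 + y) ^ 2)"
        using xy(3) by (simp add: cong_iff_dvd_diff)
      moreover have "f dvd (c 1 - m 1 * c 0) * x ^ 2 + (c 2 - m 2 * c 0) * x
          + (e - (X0 ^ 3 - lam * X0 ^ 2) * c 0) - (c 3 - m 3 * c 0) * y ^ 2 - (c 4 - m 4 * c 0) * y"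
      proof -
        have "f dvd c 1 - m 1 * c 0" "f dvd c 2 - m 2 * c 0" "f dvd c 3 - m 3 * c 0"
          "f dvd c 4 - m 4 * c 0" by (rule fdvd', simp)+
        note * = this[THEN dvd_mult2]
        show ?thesis by (rule dvd_diff[OF dvd_diff[OF dvd_add[OF dvd_add[OF *(1,2)] fe] *(3)] *(4)])
      qed
      ultimately have "f dvd c 0 * ((X0 + x) ^ 3 - lam * (X0 + y) ^ 2) +
          ((c 1 - m 1 * c 0) * x ^ 2 + (c 2 - m 2 * c 0) * x
          + (e - (X0 ^ 3 - lam * X0 ^ 2) * c 0) - (c 3 - m 3 * c 0) * y ^ 2 - (c 4 - m 4 * c 0) * y)"
        by (rule dvd_add)
      also have "\<dots> = G"
      proof -
        have m: "m 1 = 3 * X0" "m 2 = 3 * X0 ^ 2" "m 3 = lam" "m 4 = 2 * lam * X0"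
          by (simp_all add: m_def eval_nat_numeral)
        show ?thesis unfolding m G_def by algebra
      qed
      finally show ?thesis .
    qed
    ultimately have "G = 0" using dvd_polys_below_imp_0 by blast
    then show "c 3 * y ^ 2 + c 4 * y = poly [:e, c 2, c 1, c 0:] x"
      by (simp add: G_def algebra_simps power2_eq_square power3_eq_cube)
  qed
qed

section \<open>Replacing the cubic by one with small coefficients\<close>

text \<open>Over the fraction field the points span a proper subspace, because the nonzero
  \<open>F\<close> annihilates them. A basis chosen among the points is therefore small, and a
  linear form that vanishes on it vanishes on the whole span.\<close>

lemma annihilator_determined_by_few:
  fixes V :: "('b::idom ^ 'n) set"
  assumes "F \<noteq> 0" and F: "\<And>v. v \<in> V \<Longrightarrow> (\<Sum>i\<in>UNIV. F $ i * v $ i) = 0"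
  shows "\<exists>B\<subseteq>V. finite B \<and> card B < CARD('n) \<and>
    (\<forall>G. (\<forall>v\<in>B. (\<Sum>i\<in>UNIV. G $ i * v $ i) = 0) \<longrightarrow>
      (\<forall>v\<in>V. (\<Sum>i\<in>UNIV. G $ i * v $ i) = 0))"
proof -
  define \<phi> :: "'b ^ 'n \<Rightarrow> 'b fract ^ 'n" where "\<phi> v = (\<chi> i. to_fract (v $ i))" for v
  have inj: "inj \<phi>" by (auto simp: inj_def \<phi>_def vec_eq_iff)
  have phi: "(\<Sum>i\<in>UNIV. to_fract (G $ i) * \<phi> v $ i) = 0 \<longleftrightarrow> (\<Sum>i\<in>UNIV. G $ i * v $ i) = 0" for G v
  proof -
    have "to_fract (\<Sum>i\<in>UNIV. G $ i * v $ i) = (\<Sum>i\<in>UNIV. to_fract (G $ i) * \<phi> v $ i)"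
      by (simp add: \<phi>_def to_fract_sum)
    then show ?thesis by (metis to_fract_eq_0_iff)
  qed
  have sub: "vec.subspace {u :: 'b fract ^ 'n. (\<Sum>i\<in>UNIV. to_fract (G $ i) * u $ i) = 0}" for G
  proof (rule vec.subspaceI)
    fix c u assume "u \<in> {u :: 'b fract ^ 'n. (\<Sum>i\<in>UNIV. to_fract (G $ i) * u $ i) = 0}"
    then show "c *s u \<in> {u. (\<Sum>i\<in>UNIV. to_fract (G $ i) * u $ i) = 0}"
      by (simp add: mult.left_commute flip: sum_distrib_left)
  qed (auto simp: distrib_left sum.distrib)
  obtain B where B: "B \<subseteq> \<phi> ` V" "vec.independent B" "\<phi> ` V \<subseteq> vec.span B" "card B = vec.dim (\<phi> ` V)"
    by (rule vec.basis_exists)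
  have "vec.dim (\<phi> ` V) \<noteq> CARD('n)"
  proof
    assume "vec.dim (\<phi> ` V) = CARD('n)"
    then have "vec.span (\<phi> ` V) = UNIV"
      using vec.dim_eq_full[of "\<phi> ` V"] by (metis vec_dim_card vec.dim_eq_full vec.span_UNIV)
    moreover have "vec.span (\<phi> ` V) \<subseteq> {u. (\<Sum>i\<in>UNIV. to_fract (F $ i) * u $ i) = 0}"
      using F phi by (intro vec.span_minimal sub) auto
    ultimately have *: "(\<Sum>i\<in>UNIV. to_fract (F $ i) * u $ i) = 0" for u by auto
    have "F $ i = 0" for i
      using *[of "axis i 1"] by (simp add: axis_def if_distrib cong: if_cong)
    then show False using \<open>F \<noteq> 0\<close> by (simp add: vec_eq_iff)
  qed
  then have "card B < CARD('n)" using B(4) dim_subset_UNIV_cart_gen[of "\<phi> ` V"] by simp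
  obtain B' where B': "B' \<subseteq> V" "B = \<phi> ` B'" using B(1) by (auto simp: subset_image_iff)
  have "finite B" using B(2) by (rule vec.finiteI_independent)
  show ?thesis
  proof (intro exI[of _ B'] conjI allI impI ballI)
    show "B' \<subseteq> V" by (rule B')
    have "inj_on \<phi> B'" using inj by (rule inj_on_subset) simp
    then show "finite B'" "card B' < CARD('n)"
      using \<open>finite B\<close> \<open>card B < CARD('n)\<close> B'(2) by (auto simp: finite_image_iff card_image)
    fix G v assume G: "\<forall>v\<in>B'. (\<Sum>i\<in>UNIV. G $ i * v $ i) = 0" and "v \<in> V"
    have "vec.span B \<subseteq> {u. (\<Sum>i\<in>UNIV. to_fract (G $ i) * u $ i) = 0}"
      using G phi B'(2) by (intro vec.span_minimal sub) auto
    then show "(\<Sum>i\<in>UNIV. G $ i * v $ i) = 0"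
      using \<open>v \<in> V\<close> B(3) phi by blast
  qed
qed

datatype curve_monomial = X3 | X2 | X1 | Const | Y2 | Y1

lemma UNIV_curve_monomial: "UNIV = {X3, X2, X1, Const, Y2, Y1}"
  using curve_monomial.exhaust by auto

instance curve_monomial :: finite
  by standard (simp add: UNIV_curve_monomial)

primrec monomial_value :: "'b::comm_ring_1 \<Rightarrow> 'b \<Rightarrow> curve_monomial \<Rightarrow> 'b" where
  "monomial_value x y X3 = x ^ 3"
| "monomial_value x y X2 = x ^ 2"
| "monomial_value x y X1 = x"
| "monomial_value x y Const = 1"
| "monomial_value x y Y2 = y ^ 2"
| "monomial_value x y Y1 = y"

text \<open>
  At most five of the points determine all relations between the six monomials at all points, so
  there is a relation with small coefficients.  If it is not of the required shape, a combination
  with the given curve without \<open>x\<^sup>3\<close> is a nontrivial second relation.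
\<close>

lemma small_curve:
  fixes T :: "('a::{field,finite} poly \<times> 'a poly) set"
  assumes \<alpha>: "degree \<alpha> = 3" and t: "t \<noteq> 0"
    and curve: "\<And>x y. (x, y) \<in> T \<Longrightarrow> t * y ^ 2 + s * y = poly \<alpha> x"
    and deg: "\<And>x y. (x, y) \<in> T \<Longrightarrow> degree x \<le> d \<and> degree y \<le> d"
  shows "card T \<le> 38 \<or>
    (\<exists>\<alpha>' s' t'. degree \<alpha>' = 3 \<and> t' \<noteq> 0 \<and> (\<forall>i. degree (coeff \<alpha>' i) \<le> 15 * d) \<and>
      degree s' \<le> 15 * d \<and> degree t' \<le> 15 * d \<and>
      (\<forall>(x, y)\<in>T. t' * y ^ 2 + s' * y = poly \<alpha>' x))"
proof -
  have sum_UNIV: "(\<Sum>i\<in>UNIV. h i) = h X3 + h X2 + h X1 + h Const + h Y2 + h Y1"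
    for h :: "curve_monomial \<Rightarrow> 'a poly"
    by (simp add: UNIV_curve_monomial add.assoc)
  have poly_cubic: "poly p x = coeff p 0 + coeff p 1 * x + coeff p 2 * x ^ 2 + coeff p 3 * x ^ 3"
    if "degree p = 3" for p and x :: "'a poly"
    using that by (simp add: poly_altdef eval_nat_numeral)
  define V where "V = (\<lambda>(x, y). \<chi> i. monomial_value x y i) ` T"
  define F :: "'a poly ^ curve_monomial" where
    "F = (\<chi> i. case i of X3 \<Rightarrow> - coeff \<alpha> 3 | X2 \<Rightarrow> - coeff \<alpha> 2 | X1 \<Rightarrow> - coeff \<alpha> 1
      | Const \<Rightarrow> - coeff \<alpha> 0 | Y2 \<Rightarrow> t | Y1 \<Rightarrow> s)"
  have \<alpha>3: "coeff \<alpha> 3 \<noteq> 0" using \<alpha> by (metis leading_coeff_0_iff degree_0 zero_neq_numeral)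
  have "F $ Y2 \<noteq> 0" using t by (simp add: F_def)
  then have "F \<noteq> 0" by auto
  moreover have "(\<Sum>i\<in>UNIV. F $ i * v $ i) = 0" if "v \<in> V" for v
    using that curve poly_cubic[OF \<alpha>] by (auto simp: V_def F_def sum_UNIV algebra_simps)
  ultimately have "\<exists>B\<subseteq>V. finite B \<and> card B < CARD(curve_monomial) \<and>
    (\<forall>G. (\<forall>v\<in>B. (\<Sum>i\<in>UNIV. G $ i * v $ i) = 0) \<longrightarrow>
      (\<forall>v\<in>V. (\<Sum>i\<in>UNIV. G $ i * v $ i) = 0))"
    by (rule annihilator_determined_by_few)
  then obtain B where B: "B \<subseteq> V" "finite B" "card B < CARD(curve_monomial)"
    and ann: "\<And>G v. (\<forall>v\<in>B. (\<Sum>i\<in>UNIV. G $ i * v $ i) = 0) \<Longrightarrow>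
      v \<in> V \<Longrightarrow> (\<Sum>i\<in>UNIV. G $ i * v $ i) = 0"
    by blast
  have "card B \<le> 5" using B(3) by (simp add: UNIV_curve_monomial)
  \<comment> \<open>A relation with entries in \<open>polys_below e\<close> has values in
    \<open>polys_below (e + 3 * d)\<close> at the points, so vanishing amounts to divisibility by
    the monomial of degree \<open>e + 3 * d\<close>. Five points against six unknowns require
    \<open>5 * (e + 3 * d) < 6 * e\<close>, that is \<open>15 * d < e\<close>.\<close>
  define e where "e = 15 * d + 1"
  have "card B * (e + 3 * d) \<le> 5 * (e + 3 * d)" using \<open>card B \<le> 5\<close> by (rule mult_right_mono) simp
  then have "(\<Sum>v\<in>B. degree (monom 1 (e + 3 * d) :: 'a poly)) < (\<Sum>i\<in>(UNIV :: curve_monomial set). e)"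
    by (simp add: degree_monom_eq UNIV_curve_monomial e_def)
  then have "\<exists>G. (\<forall>i\<in>UNIV. G i \<in> polys_below e) \<and> (\<exists>i\<in>(UNIV :: curve_monomial set). G i \<noteq> 0) \<and>
      (\<forall>v\<in>B. monom 1 (e + 3 * d) dvd (\<Sum>i\<in>UNIV. v $ i * G i))"
    using B(2) by (intro small_solution_congruences) (auto simp: monom_eq_0_iff)
  then obtain G where G: "\<And>i. G i \<in> polys_below e" and G0: "\<exists>i. G i \<noteq> 0"
    and Gdvd: "\<And>v. v \<in> B \<Longrightarrow> monom 1 (e + 3 * d) dvd (\<Sum>i\<in>UNIV. v $ i * G i)"
    by auto
  have "(\<Sum>i\<in>UNIV. (\<chi> i. G i) $ i * v $ i) = 0" if vB: "v \<in> B" for v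
  proof -
    obtain x y where v: "v = (\<chi> i. monomial_value x y i)" and xy: "(x, y) \<in> T"
      using subsetD[OF B(1) vB] by (auto simp: V_def)
    have "degree (v $ i) \<le> 3 * d" for i
      using deg[OF xy] degree_power_le[of x 2] degree_power_le[of x 3] degree_power_le[of y 2]
      by (cases i) (auto simp: v)
    then have "(\<Sum>i\<in>UNIV. G i * v $ i) \<in> polys_below (e + 3 * d)"
      by (intro polys_below_sum polys_below_mult G)
    moreover have "monom 1 (e + 3 * d) dvd (\<Sum>i\<in>UNIV. G i * v $ i)"
      using Gdvd[OF vB] by (simp add: mult.commute)
    ultimately show ?thesis
      using dvd_polys_below_imp_0[of "monom 1 (e + 3 * d)"] by (simp add: degree_monom_eq)
  qed
  then have annG: "(\<Sum>i\<in>UNIV. G i * v $ i) = 0" if "v \<in> V" for v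
    using ann[of "\<chi> i. G i" v] that by simp
  have rel: "G X3 * x ^ 3 + G X2 * x ^ 2 + G X1 * x + G Const + G Y2 * y ^ 2 + G Y1 * y = 0"
    if "(x, y) \<in> T" for x y
    using annG[of "\<chi> i. monomial_value x y i"] that by (force simp: V_def sum_UNIV)
  show ?thesis
  proof (cases "G X3 \<noteq> 0 \<and> G Y2 \<noteq> 0")
    case True
    have "degree (G i) \<le> 15 * d" for i
      using G[of i] by (simp add: e_def flip: polys_below_Suc_iff)
    moreover have "(- G Y2) * y ^ 2 + (- G Y1) * y = poly [:G Const, G X1, G X2, G X3:] x"
      if "(x, y) \<in> T" for x y
    proof -
      have "(- G Y2) * y ^ 2 + (- G Y1) * y - poly [:G Const, G X1, G X2, G X3:] x =
          - (G X3 * x ^ 3 + G X2 * x ^ 2 + G X1 * x + G Const + G Y2 * y ^ 2 + G Y1 * y)"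
        by (simp add: algebra_simps power2_eq_square power3_eq_cube)
      then show ?thesis using rel[OF that] by simp
    qed
    moreover have "degree (coeff [:G Const, G X1, G X2, G X3:] i) \<le> 15 * d" for i
      using calculation(1) by (auto simp: coeff_pCons split: nat.split)
    ultimately show ?thesis
      using True
      by (intro disjI2 exI[of _ "[:G Const, G X1, G X2, G X3:]"] exI[of _ "- G Y1"] exI[of _ "- G Y2"]) auto
  next
    case False
    \<comment> \<open>In \<open>coeff \<alpha> 3\<close> times the small relation plus
      \<open>G X3\<close> times the given one the cubes of \<open>x\<close> cancel. The rest is
      nontrivial: for \<open>G X3 = 0\<close> it is a multiple of the small relation, otherwise
      \<open>G Y2 = 0\<close> and \<open>y ^ 2\<close> has coefficient
      \<open>G X3 * t\<close>.\<close>
    define c where "c i j = coeff \<alpha> 3 * ([[G Const, G Y1, G Y2], [G X1, 0, 0], [G X2, 0, 0]] ! i ! j)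
      + G X3 * ([[- coeff \<alpha> 0, s, t], [- coeff \<alpha> 1, 0, 0], [- coeff \<alpha> 2, 0, 0]] ! i ! j)" for i j :: nat
    have "finite T \<and> card T \<le> 12 * 2 + 14"
    proof (rule card_curve_points_le[OF \<alpha> t _ curve])
      show "\<exists>i\<le>2. \<exists>j\<le>2. c i j \<noteq> 0"
      proof (cases "G X3 = 0")
        case True
        obtain i where "G i \<noteq> 0" using G0 by blast
        with True \<alpha>3 have "c 0 0 \<noteq> 0 \<or> c 0 1 \<noteq> 0 \<or> c 0 2 \<noteq> 0 \<or> c 1 0 \<noteq> 0 \<or> c 2 0 \<noteq> 0"
          by (cases i) (auto simp: c_def)
        then show ?thesis by (meson le_refl one_le_numeral zero_le)
      next
        case X3: False
        with False have "c 0 2 \<noteq> 0" using t by (simp add: c_def)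
        then show ?thesis by (meson le_refl zero_le)
      qed
      fix x y assume xy: "(x, y) \<in> T"
      have "(\<Sum>(i, j)\<in>{..2} \<times> {..2}. c i j * (x ^ i * y ^ j)) =
          coeff \<alpha> 3 * (G X3 * x ^ 3 + G X2 * x ^ 2 + G X1 * x + G Const + G Y2 * y ^ 2 + G Y1 * y)
          + G X3 * (t * y ^ 2 + s * y - poly \<alpha> x)"
        unfolding poly_cubic[OF \<alpha>]
        by (simp add: c_def eval_nat_numeral algebra_simps flip: sum.cartesian_product)
      then show "(\<Sum>(i, j)\<in>{..2} \<times> {..2}. c i j * (x ^ i * y ^ j)) = 0"
        using rel[OF xy] curve[OF xy] by simp
    qed simp
    then show ?thesis by simp
  qed
qed

subsection \<open>Irreducible polynomials of small degree\<close>

lemma irreducible_factor_exists: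
  fixes g :: "'a::field poly"
  assumes "degree g > 0"
  shows "\<exists>P. irreducible P \<and> P dvd g"
  using assms
proof (induction "degree g" arbitrary: g rule: less_induct)
  case less
  show ?case
  proof (cases "irreducible g")
    case False
    have "g \<noteq> 0" using less.prems by auto
    then have "\<not> is_unit g" using less.prems by (simp add: is_unit_iff_degree)
    with False \<open>g \<noteq> 0\<close> obtain a b where ab: "g = a * b" "\<not> is_unit a" "\<not> is_unit b"
      by (auto simp: irreducible_def)
    then have "a \<noteq> 0" "b \<noteq> 0" using \<open>g \<noteq> 0\<close> by auto
    then have "degree a > 0" "degree b > 0" using ab by (auto simp: is_unit_iff_degree)
    then have "degree a < degree g" using ab \<open>a \<noteq> 0\<close> \<open>b \<noteq> 0\<close> by (simp add: degree_mult_eq)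
    from less.hyps[OF this \<open>degree a > 0\<close>] show ?thesis using ab by auto
  qed auto
qed

text \<open>Cancel an irreducible factor \<open>P\<close> from both \<open>Q\<close> and
  \<open>g\<close>. As \<open>P ^ 2\<close> does not divide \<open>Q\<close>, no irreducible factor
  of the remaining quotient divides \<open>P\<close>, so each still divides the rest of
  \<open>g\<close>.\<close>

lemma squarefree_dvd_if_irreducible_factors_dvd:
  fixes Q g :: "'a::field poly"
  assumes "Q \<noteq> 0" and "\<And>P. irreducible P \<Longrightarrow> \<not> P ^ 2 dvd Q"
    and "\<And>P. irreducible P \<Longrightarrow> P dvd Q \<Longrightarrow> P dvd g"
  shows "Q dvd g"
  using assms
proof (induction "degree Q" arbitrary: Q g rule: less_induct)
  case less
  show ?case
  proof (cases "degree Q = 0")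
    case True
    then have "is_unit Q" using less.prems by (simp add: is_unit_iff_degree)
    then show ?thesis by (rule unit_imp_dvd)
  next
    case False
    then obtain P where P: "irreducible P" "P dvd Q" using irreducible_factor_exists[of Q] by auto
    then have pP: "prime_elem P" by (intro field_poly_irreducible_imp_prime)
    obtain Q1 where Q1: "Q = P * Q1" using P by (auto elim: dvdE)
    obtain g1 where g1: "g = P * g1" using less.prems(3)[OF P] by (auto elim: dvdE)
    have nz: "P \<noteq> 0" "Q1 \<noteq> 0" using Q1 less.prems by auto
    have "degree P > 0" using P(1) nz by (auto simp: irreducible_def is_unit_iff_degree)
    then have "degree Q1 < degree Q" using nz by (simp add: Q1 degree_mult_eq)
    moreover have "\<not> R ^ 2 dvd Q1" if "irreducible R" for R
      using less.prems(2)[OF that] by (auto simp: Q1)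
    moreover have "R dvd g1" if R: "irreducible R" "R dvd Q1" for R
    proof -
      have pR: "prime_elem R" using R by (intro field_poly_irreducible_imp_prime)
      have "\<not> R dvd P"
      proof
        assume "R dvd P"
        then have "P dvd R" using P(1) R(1) by (meson irreducibleD' irreducible_not_unit)
        then have "P ^ 2 dvd Q" using R(2) by (auto simp: Q1 power2_eq_square intro: dvd_trans)
        then show False using less.prems(2)[OF P(1)] by simp
      qed
      moreover have "R dvd P * g1" using less.prems(3)[OF R(1)] R(2) by (simp add: Q1 g1)
      ultimately show ?thesis using pR by (simp add: prime_elem_dvd_mult_iff)
    qed
    ultimately have "Q1 dvd g1" by (rule less.hyps[OF _ nz(2)])
    then show ?thesis by (simp add: Q1 g1)
  qed
qed

text \<open>Lagrange's bound modulo \<open>P\<close> without forming the residue ring: synthetic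
  division at a root \<open>a\<close> keeps the polynomial monic, lowers the degree by one and
  retains every root incongruent to \<open>a\<close>.\<close>

lemma card_incongruent_roots_le:
  fixes \<Phi> :: "'b::comm_ring_1 poly"
  assumes P: "prime_elem P" and monic: "lead_coeff \<Phi> = 1"
    and "finite A" and root: "\<And>a. a \<in> A \<Longrightarrow> P dvd poly \<Phi> a"
    and inc: "\<And>a b. a \<in> A \<Longrightarrow> b \<in> A \<Longrightarrow> P dvd a - b \<Longrightarrow> a = b"
  shows "card A \<le> degree \<Phi>"
  using monic \<open>finite A\<close> root inc
proof (induction "degree \<Phi>" arbitrary: \<Phi> A)
  case 0
  then have "\<Phi> = 1" by (metis lead_coeff_1 degree_0_id one_pCons degree_eq_zeroE coeff_pCons_0)
  then have "A = {}" using 0 P by (auto simp: prime_elem_def)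
  then show ?case by simp
next
  case (Suc n)
  show ?case
  proof (cases "A = {}")
    case False
    then obtain a where a: "a \<in> A" by auto
    define \<Psi> where "\<Psi> = synthetic_div \<Phi> a"
    have eq: "\<Phi> + smult a \<Psi> = pCons (poly \<Phi> a) \<Psi>"
      unfolding \<Psi>_def by (rule synthetic_div_correct)
    have deg: "degree \<Psi> = n" unfolding \<Psi>_def degree_synthetic_div using Suc by simp
    have "coeff (\<Phi> + smult a \<Psi>) (Suc n) = coeff \<Psi> n" by (simp add: eq)
    then have "lead_coeff \<Psi> = 1" using Suc(2,3) deg by (simp add: coeff_eq_0)
    moreover have "P dvd poly \<Psi> b" if b: "b \<in> A - {a}" for b
    proof -
      have "poly \<Phi> b + a * poly \<Psi> b = poly \<Phi> a + b * poly \<Psi> b"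
        using arg_cong[OF eq, of "\<lambda>p. poly p b"] by simp
      then have "poly \<Phi> b - poly \<Phi> a = (b - a) * poly \<Psi> b" by (simp add: algebra_simps)
      moreover have "P dvd poly \<Phi> b - poly \<Phi> a" using Suc.prems(3) a b by (intro dvd_diff) auto
      ultimately have "P dvd (b - a) * poly \<Psi> b" by simp
      then show ?thesis using P Suc.prems(4)[of b a] a b by (auto simp: prime_elem_dvd_mult_iff)
    qed
    ultimately have "card (A - {a}) \<le> degree \<Psi>"
      using Suc.prems by (intro Suc.hyps) (auto simp: deg)
    then show ?thesis using a Suc.prems(2) deg Suc(2) by simp
  qed simp
qed

text \<open>
  With \<open>p = CHAR('a)\<close>, modulo \<open>P\<close> every polynomial over the prime field is a root of
  \<open>Z ^ (p ^ k) - Z\<close>, and \<open>p ^ (k + 1)\<close> of them would be incongruent if \<open>degree P > k\<close>.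
\<close>

lemma degree_le_if_dvd_X_pow_diff_X:
  fixes P :: "'a::{field,finite} poly"
  assumes P: "irreducible P" and "k > 0" and dvd: "P dvd monom 1 (CHAR('a) ^ k) - monom 1 1"
  shows "degree P \<le> k"
proof (rule ccontr)
  assume "\<not> degree P \<le> k"
  define p where "p = CHAR('a)"
  have p: "prime p" unfolding p_def by (rule prime_CHAR_semidom) (simp add: finite_imp_CHAR_pos)
  define E where "E = (of_nat ` {..<p} :: 'a set)"
  have "inj_on (of_nat :: nat \<Rightarrow> 'a) {..<p}"
    by (auto simp: inj_on_def of_nat_eq_iff_cong_CHAR p_def intro: cong_less_modulus_unique_nat)
  then have cardE: "card E = p" by (simp add: E_def card_image)
  have frob: "(of_nat n :: 'a) ^ (p ^ k) = of_nat n" for n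
  proof (induction n)
    case (Suc n)
    then show ?case using freshmans_dream'[of "p ^ k" k "1 :: 'a" "of_nat n"] p by (simp add: p_def)
  qed (use p in \<open>simp add: prime_gt_0_nat\<close>)
  define A where "A = (\<lambda>c. \<Sum>i\<le>k. monom (c i) i) ` (Pi\<^sub>E {..k} (\<lambda>_. E))"
  have coeffA: "coeff (\<Sum>i\<le>k. monom (c i) i) j = (if j \<le> k then c j else 0)" for c :: "nat \<Rightarrow> 'a" and j
    by (simp add: coeff_sum if_distrib cong: if_cong)
  have "inj_on (\<lambda>c. \<Sum>i\<le>k. monom (c i) i :: 'a poly) (Pi\<^sub>E {..k} (\<lambda>_. E))"
  proof (rule inj_onI)
    fix c c' assume c: "c \<in> Pi\<^sub>E {..k} (\<lambda>_. E)" "c' \<in> Pi\<^sub>E {..k} (\<lambda>_. E)"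
      and "(\<Sum>i\<le>k. monom (c i) i) = (\<Sum>i\<le>k. monom (c' i) i)"
    then have "c j = c' j" if "j \<le> k" for j using that coeffA by metis
    then show "c = c'" using c by (intro PiE_ext) auto
  qed
  then have "card A = card (Pi\<^sub>E {..k} (\<lambda>_. E))" unfolding A_def by (rule card_image)
  also have "\<dots> = p ^ Suc k" by (simp add: card_PiE cardE)
  finally have cardA: "card A = p ^ Suc k" .
  define \<Phi> where "\<Phi> = (monom 1 (p ^ k) - monom 1 1 :: 'a poly poly)"
  have pk: "p ^ k > 1" using p \<open>k > 0\<close> by (intro one_less_power prime_gt_1_nat)
  have "card A \<le> degree \<Phi>"
  proof (rule card_incongruent_roots_le)
    show "prime_elem P" using P by (rule field_poly_irreducible_imp_prime)
    have deg: "degree \<Phi> = p ^ k"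
      using degree_add_eq_left[of "- monom 1 1" "monom (1 :: 'a poly) (p ^ k)"] pk
      by (simp add: \<Phi>_def degree_monom_eq)
    show "lead_coeff \<Phi> = 1" unfolding deg using pk by (simp add: \<Phi>_def)
    show "finite A" unfolding A_def E_def by (intro finite_imageI finite_PiE) auto
  next
    fix a assume "a \<in> A"
    then obtain c where c: "c \<in> Pi\<^sub>E {..k} (\<lambda>_. E)" and a: "a = (\<Sum>i\<le>k. monom (c i) i)"
      by (auto simp: A_def)
    \<comment> \<open>Frobenius fixes the coefficients, so this power is \<open>a\<close> evaluated
      at \<open>monom 1 (p ^ k)\<close>; subtracting \<open>a\<close> itself leaves a multiple of
      \<open>monom 1 (p ^ k) - monom 1 1\<close>.\<close>
    have "a ^ (p ^ k) = (\<Sum>i\<le>k. monom (c i) i ^ (p ^ k))"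
      unfolding a using p by (intro freshmans_dream_sum'[of _ k]) (auto simp: p_def)
    also have "\<dots> = (\<Sum>i\<le>k. smult (c i) (monom 1 (p ^ k) ^ i))"
    proof (rule sum.cong[OF refl])
      fix i assume "i \<in> {..k}"
      then have "c i \<in> E" using c by auto
      then have "c i ^ (p ^ k) = c i" using frob by (auto simp: E_def)
      then show "monom (c i) i ^ (p ^ k) = smult (c i) (monom 1 (p ^ k) ^ i)"
        by (simp add: monom_power smult_monom mult.commute)
    qed
    finally have "poly \<Phi> a = (\<Sum>i\<le>k. smult (c i) (monom 1 (p ^ k) ^ i - monom 1 1 ^ i))"
      by (simp add: \<Phi>_def poly_monom a smult_diff_right sum_subtractf smult_monom monom_power)
    moreover have "P dvd monom 1 (p ^ k) ^ i - monom 1 1 ^ i" for i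
      using dvd unfolding p_def[symmetric]
      by (rule dvd_trans) (simp add: power_diff_sumr2)
    ultimately show "P dvd poly \<Phi> a" by (auto intro!: dvd_sum dvd_smult)
  next
    fix a b assume ab: "a \<in> A" "b \<in> A" "P dvd a - b"
    have "degree a \<le> k" if "a \<in> A" for a
      using that by (auto simp: A_def intro!: degree_sum_le intro: order_trans[OF degree_monom_le])
    then have "degree (a - b) \<le> k" using ab by (intro degree_diff_le) auto
    then show "a = b"
      using dvd_imp_degree_le[OF ab(3)] \<open>\<not> degree P \<le> k\<close> by force
  qed
  also have "degree \<Phi> \<le> p ^ k"
    unfolding \<Phi>_def using pk by (intro degree_diff_le) (auto simp: degree_monom_eq)
  finally have "card A \<le> p ^ k" .
  moreover have "p ^ k < p ^ Suc k" using prime_gt_1_nat[OF p] by simp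
  ultimately show False using cardA by simp
qed

text \<open>Otherwise all irreducible factors of the squarefree \<open>Q\<close>, which have degree
  at most \<open>k\<close>, would divide \<open>g\<close>, and so would \<open>Q\<close>, whose
  degree is at least \<open>2 ^ k\<close>.\<close>

lemma irreducible_not_dvd_exists:
  fixes g :: "'a::{field,finite} poly"
  assumes "g \<noteq> 0" "degree g < 2 ^ k" "k > 0"
  shows "\<exists>P. irreducible P \<and> degree P \<le> k \<and> \<not> P dvd g"
proof -
  define p where "p = CHAR('a)"
  have p: "prime p" unfolding p_def by (rule prime_CHAR_semidom) (simp add: finite_imp_CHAR_pos)
  have pk: "p ^ k > 1" using p \<open>k > 0\<close> by (intro one_less_power prime_gt_1_nat)
  define Q where "Q = (monom 1 (p ^ k) - monom 1 1 :: 'a poly)"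
  have deg: "degree Q = p ^ k"
    using degree_add_eq_left[of "- monom 1 1" "monom (1 :: 'a) (p ^ k)"] pk
    by (simp add: Q_def degree_monom_eq)
  have "(of_nat (p ^ k) :: 'a) = 0" using \<open>k > 0\<close> by (simp add: of_nat_eq_0_iff_char_dvd p_def)
  \<comment> \<open>A unit as derivative excludes repeated irreducible factors of
    \<open>Q\<close>.\<close>
  then have deriv: "pderiv Q = - 1"
    using \<open>k > 0\<close> by (simp add: Q_def pderiv_diff pderiv_monom monom_0 one_pCons power_0_left)
  show ?thesis
  proof (rule ccontr)
    assume contra: "\<not> ?thesis"
    have "Q dvd g"
    proof (rule squarefree_dvd_if_irreducible_factors_dvd)
      show "Q \<noteq> 0" using deg pk by (metis degree_0 not_one_less_zero)
      fix P :: "'a poly" assume P: "irreducible P"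
      show "\<not> P ^ 2 dvd Q"
      proof
        assume "P ^ 2 dvd Q"
        then obtain R where "Q = P ^ 2 * R" by (auto elim: dvdE)
        then have "pderiv Q = P * (P * pderiv R + 2 * pderiv P * R)"
          by (simp add: pderiv_mult power2_eq_square algebra_simps)
        then have "P dvd - 1" unfolding deriv by (metis dvd_triv_left)
        then show False using P by (auto simp: irreducible_def)
      qed
      show "P dvd g" if "P dvd Q"
        using degree_le_if_dvd_X_pow_diff_X[OF P _ that[unfolded Q_def p_def]] contra P \<open>k > 0\<close> by blast
    qed
    then have "p ^ k \<le> degree g" using dvd_imp_degree_le[OF _ assms(1)] deg by metis
    moreover have "2 ^ k \<le> p ^ k" using p by (intro power_mono prime_ge_2_nat) auto
    ultimately show False using assms by simp
  qed
qed

subsection \<open>Local parametrization and the auxiliary polynomial\<close>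

lemma prime_elem_power_dvd_multD:
  fixes P :: "'b::algebraic_semidom"
  assumes P: "prime_elem P" and b: "\<not> P dvd b"
  shows "P ^ n dvd b * r \<Longrightarrow> P ^ n dvd r"
  using prime_elem_power_dvd_cases[of P n b r 1 n] assms by auto

text \<open>Pigeonhole with one unknown in \<open>polys_below (degree (P ^ n))\<close> and one
  constant unknown makes a multiple of \<open>b\<close> congruent to a constant. The constant is
  nonzero since \<open>b\<close> is prime to \<open>P\<close>, and dividing by it gives the
  inverse.\<close>

lemma inverse_mod_prime_power:
  fixes P :: "'a::{field,finite} poly"
  assumes P: "prime_elem P" and b: "\<not> P dvd b"
  shows "\<exists>r. P ^ n dvd r * b - 1"
proof -
  have P0: "P ^ n \<noteq> 0" using P by auto
  define e where "e i = (if i then degree (P ^ n) else 1)" for i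
  have "\<exists>c. (\<forall>i\<in>{True, False}. c i \<in> polys_below (e i)) \<and> (\<exists>i\<in>{True, False}. c i \<noteq> 0) \<and>
      (\<forall>k\<in>{0::nat}. P ^ n dvd (\<Sum>i\<in>{True, False}. (if i then b else - 1) * c i))"
    using P0 by (intro small_solution_congruences) (auto simp: e_def)
  then obtain c where c: "c True \<in> polys_below (degree (P ^ n))" "c False \<in> polys_below 1"
      "c True \<noteq> 0 \<or> c False \<noteq> 0" "P ^ n dvd b * c True - c False"
    by (simp add: e_def) blast
  have "c False \<noteq> 0"
  proof
    assume "c False = 0"
    then have "P ^ n dvd b * c True" using c(4) by simp
    then have "P ^ n dvd c True" by (rule prime_elem_power_dvd_multD[OF P b])
    then have "c True = 0" using c(1) by (rule dvd_polys_below_imp_0)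
    then show False using c(3) \<open>c False = 0\<close> by simp
  qed
  moreover from c(2) have "degree (c False) = 0" by (auto simp: polys_below_iff)
  ultimately obtain w where w: "c False = [:w:]" "w \<noteq> 0" by (auto elim!: degree_eq_zeroE)
  have "P ^ n dvd smult (inverse w) (b * c True - c False)" using c(4) by (rule dvd_smult)
  then show ?thesis
    using w by (intro exI[of _ "smult (inverse w) (c True)"]) (simp add: smult_diff_right mult.commute one_pCons)
qed

lemma diff_dvd_poly_diff: "x - y dvd poly p x - poly p y" for x y :: "'b::comm_ring_1"
proof (induction p)
  case (pCons a p)
  have "poly (pCons a p) x - poly (pCons a p) y = x * (poly p x - poly p y) + (x - y) * poly p y"
    by (simp add: algebra_simps)
  then show ?case using pCons by simp
qed simp

text \<open>Newton's iteration for the Taylor expansion of \<open>\<beta>(y) = \<alpha>(x)\<close> at \<open>(x0, y0)\<close>.\<close>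

lemma local_parametrization:
  fixes \<alpha> \<beta> :: "'a::{field,finite} poly poly"
  assumes P: "prime_elem P" and deriv: "\<not> P dvd poly (pderiv \<beta>) y0"
    and base: "poly \<beta> y0 = poly \<alpha> x0"
    and T: "\<And>x y. (x, y) \<in> T \<Longrightarrow> poly \<beta> y = poly \<alpha> x \<and> P ^ m dvd x - x0 \<and> P dvd y - y0"
  shows "\<exists>\<phi>. \<forall>(x, y)\<in>T. P ^ (m * K) dvd y - poly \<phi> (x - x0)"
proof -
  obtain b0 b1 S where S: "pcompose \<beta> [:y0, 1:] = pCons b0 (pCons b1 S)" by (metis pCons_cases)
  obtain a0 R where R: "pcompose \<alpha> [:x0, 1:] = pCons a0 R" by (metis pCons_cases)
  have \<beta>: "poly \<beta> (y0 + v) = b0 + v * (b1 + v * poly S v)" for v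
    using arg_cong[OF S, of "\<lambda>p. poly p v"] by (simp add: poly_pcompose algebra_simps)
  have \<alpha>: "poly \<alpha> (x0 + u) = a0 + u * poly R u" for u
    using arg_cong[OF R, of "\<lambda>p. poly p u"] by (simp add: poly_pcompose algebra_simps)
  have "poly (pderiv (pcompose \<beta> [:y0, 1:])) 0 = b1"
    unfolding S by (simp add: pderiv_pCons)
  then have b1: "poly (pderiv \<beta>) y0 = b1"
    by (simp add: pderiv_pcompose poly_pcompose pderiv_pCons)
  have "a0 = b0" using \<alpha>[of 0] \<beta>[of 0] base by simp
  have eq: "(y - y0) * (b1 + (y - y0) * poly S (y - y0)) = (x - x0) * poly R (x - x0)"
    if "(x, y) \<in> T" for x y
    using T[OF that] \<beta>[of "y - y0"] \<alpha>[of "x - x0"] \<open>a0 = b0\<close> by simp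
  \<comment> \<open>In \<open>eq\<close> the cofactor of \<open>y - y0\<close> is prime to
    \<open>P\<close>, since \<open>P\<close> divides \<open>y - y0\<close> but not
    \<open>b1\<close>; hence the factor \<open>P ^ m\<close> passes from \<open>x - x0\<close> to
    \<open>y - y0\<close>.\<close>
  have v: "P ^ m dvd y - y0" if xy: "(x, y) \<in> T" for x y
  proof (rule prime_elem_power_dvd_multD[OF P])
    have "P dvd (y - y0) * poly S (y - y0)" using T[OF xy] by simp
    then show "\<not> P dvd b1 + (y - y0) * poly S (y - y0)"
      using deriv b1 by (simp add: dvd_add_left_iff)
    show "P ^ m dvd (b1 + (y - y0) * poly S (y - y0)) * (y - y0)"
      using eq[OF xy] T[OF xy] by (simp add: mult.commute)
  qed
  obtain r where r: "P ^ (m * K) dvd r * b1 - 1"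
    using inverse_mod_prime_power[OF P] deriv b1 by blast
  have newton: "\<exists>\<phi>. \<forall>(x, y)\<in>T. P ^ m dvd poly \<phi> (x - x0) \<and>
      P ^ (m * Suc n) dvd (y - y0) - poly \<phi> (x - x0)" if "Suc n \<le> K" for n
    using that
  proof (induction n)
    case 0
    show ?case using v by (intro exI[of _ 0]) auto
  next
    case (Suc n)
    then obtain \<phi> where \<phi>: "\<And>x y. (x, y) \<in> T \<Longrightarrow> P ^ m dvd poly \<phi> (x - x0)"
      "\<And>x y. (x, y) \<in> T \<Longrightarrow> P ^ (m * Suc n) dvd (y - y0) - poly \<phi> (x - x0)"
      by fastforce
    \<comment> \<open>For \<open>u = x - x0\<close> and \<open>w = y - y0\<close> the curve says
      \<open>b1 * w = u * R(u) - w ^ 2 * S(w)\<close>; here the old approximation is put in for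
      \<open>w\<close> on the right. Both are divisible by \<open>P ^ m\<close>, so replacing one by
      the other in \<open>w ^ 2 * S(w)\<close> gains a factor \<open>P ^ m\<close>.\<close>
    define \<psi> where "\<psi> = smult r (pCons 0 R - \<phi> ^ 2 * pcompose S \<phi>)"
    have "P ^ m dvd poly \<psi> (x - x0) \<and> P ^ (m * Suc (Suc n)) dvd (y - y0) - poly \<psi> (x - x0)"
      if xy: "(x, y) \<in> T" for x y
    proof
      define u where "u = x - x0"
      define w where "w = y - y0"
      define z where "z = poly \<phi> u"
      have dvds: "P ^ m dvd u" "P ^ m dvd w" "P ^ m dvd z" "P ^ (m * Suc n) dvd w - z"
        using T[OF xy] v[OF xy] \<phi>[OF xy] by (simp_all add: u_def w_def z_def)
      have \<psi>: "poly \<psi> u = r * (u * poly R u - z ^ 2 * poly S z)"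
        by (simp add: \<psi>_def z_def poly_pcompose)
      have "P ^ m dvd u * poly R u - z ^ 2 * poly S z"
        using dvds by (intro dvd_diff dvd_mult2) (simp_all add: power2_eq_square)
      then show "P ^ m dvd poly \<psi> (x - x0)"
        unfolding u_def[symmetric] \<psi> by (rule dvd_mult)
      have "w - poly \<psi> u = - ((r * b1 - 1) * w) - r * (w ^ 2 * poly S w - z ^ 2 * poly S z)"
      proof -
        have "u * poly R u = w * (b1 + w * poly S w)" using eq[OF xy] by (simp add: u_def w_def)
        then show ?thesis unfolding \<psi> by (simp add: algebra_simps power2_eq_square)
      qed
      moreover have "P ^ (m * Suc (Suc n)) dvd (r * b1 - 1) * w"
        using Suc.prems by (intro dvd_mult2 dvd_trans[OF le_imp_power_dvd r] mult_le_mono2)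
      moreover have "P ^ (m * Suc (Suc n)) dvd w ^ 2 * poly S w - z ^ 2 * poly S z"
      proof -
        have "w ^ 2 * poly S w - z ^ 2 * poly S z =
            (w - z) * (w + z) * poly S w + z * z * (poly S w - poly S z)"
          by (simp add: algebra_simps power2_eq_square)
        moreover have "P ^ (m * Suc n) * P ^ m dvd (w - z) * (w + z)"
          using dvds by (intro mult_dvd_mono dvd_add)
        moreover have "P ^ (m * Suc n) * P ^ m dvd (poly S w - poly S z) * z"
          using dvds dvd_trans[OF dvds(4) diff_dvd_poly_diff[of w z S]] by (intro mult_dvd_mono)
        then have "P ^ (m * Suc n) * P ^ m dvd (poly S w - poly S z) * z * z" by (rule dvd_mult2)
        then have "P ^ (m * Suc n) * P ^ m dvd z * z * (poly S w - poly S z)"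
          by (simp only: ac_simps)
        moreover have "m * Suc (Suc n) = m * Suc n + m" by simp
        then have "P ^ (m * Suc (Suc n)) = P ^ (m * Suc n) * P ^ m" by (simp only: power_add)
        ultimately show ?thesis by (metis dvd_add dvd_mult2)
      qed
      ultimately show "P ^ (m * Suc (Suc n)) dvd (y - y0) - poly \<psi> (x - x0)"
        unfolding u_def[symmetric] w_def[symmetric] by (simp add: dvd_diff)
    qed
    then show ?case by blast
  qed
  show ?thesis
  proof (cases K)
    case (Suc n)
    then obtain \<phi> where "\<And>x y. (x, y) \<in> T \<Longrightarrow> P ^ (m * K) dvd (y - y0) - poly \<phi> (x - x0)"
      using newton[of n] by fastforce
    then show ?thesis by (intro exI[of _ "[:y0:] + \<phi>"]) (auto simp: algebra_simps)
  qed auto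
qed

text \<open>The average degree of the \<open>3 * (D + 1)\<close> monomials is (D + 2) / 2; this
  measures the loss caused by the size of \<open>x\<close> and \<open>y\<close>.\<close>

lemma sum_exponents: "2 * (\<Sum>(i, j)\<in>{..2::nat} \<times> {..D}. i + j) = 3 * (D + 1) * (D + 2)"
proof -
  have "2 * (\<Sum>i\<le>2::nat. \<Sum>j\<le>D. i + j) = 3 * (D + 1) * (D + 2)"
    by (induction D) (simp_all add: eval_nat_numeral)
  then show ?thesis by (simp add: sum.cartesian_product)
qed

text \<open>
  The \<open>k\<close>-th coefficient in \<open>u\<close> of the combination is forced to be divisible by \<open>P ^ (m * (K - k))\<close>.
  At the points of \<open>T\<close> the combination is then divisible by \<open>P ^ (m * K)\<close>, and it vanishes there
  because its degree is smaller than that.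
\<close>

lemma auxiliary_polynomial:
  fixes P :: "'a::{field,finite} poly" and u :: "'a poly \<Rightarrow> 'a poly \<Rightarrow> 'a poly"
  assumes P: "P \<noteq> 0" and m: "d * (D + 2) < m * degree P * (3 * D + 2)"
    and K: "K = 3 * (D + 1)"
    and deg: "\<And>x y. (x, y) \<in> T \<Longrightarrow> degree x \<le> d \<and> degree y \<le> d"
    and u: "\<And>x y. (x, y) \<in> T \<Longrightarrow> P ^ m dvd u x y"
    and \<xi>: "\<And>x y. (x, y) \<in> T \<Longrightarrow> P ^ (m * K) dvd x - poly \<xi> (u x y)"
    and \<eta>: "\<And>x y. (x, y) \<in> T \<Longrightarrow> P ^ (m * K) dvd y - poly \<eta> (u x y)"
  shows "\<exists>c. (\<exists>i\<le>2. \<exists>j\<le>D. c i j \<noteq> 0) \<and>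
    (\<forall>(x, y)\<in>T. (\<Sum>(i, j)\<in>{..2::nat} \<times> {..D}. c i j * (x ^ i * y ^ j)) = 0)"
proof -
  define J where "J = {..2::nat} \<times> {..D}"
  define \<mu> where "\<mu> = m * degree P"
  define e where "e ij = \<mu> * K - (fst ij + snd ij) * d" for ij :: "nat \<times> nat"
  have cardJ: "card J = K" by (simp add: J_def K)
  have "d * (D + 2) \<le> \<mu> * K"
  proof -
    have "\<mu> * (3 * D + 2) \<le> \<mu> * K" by (intro mult_left_mono) (simp_all add: K)
    then show ?thesis using m by (simp add: \<mu>_def)
  qed
  \<comment> \<open>So the subtraction in \<open>e\<close> never truncates.\<close>
  then have le: "(fst ij + snd ij) * d \<le> \<mu> * K" if "ij \<in> J" for ij
    using that mult_right_mono[of "fst ij + snd ij" "D + 2" d]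
    by (auto simp: J_def mult.commute)
  have degPK: "degree (P ^ (m * k)) = \<mu> * k" for k
    using P by (simp add: degree_power_eq \<mu>_def mult_ac)
  have sum_e: "2 * (\<Sum>ij\<in>J. e ij) + d * (K * (D + 2)) = 2 * (K * (\<mu> * K))"
  proof -
    have "(\<Sum>ij\<in>J. e ij) + (\<Sum>ij\<in>J. (fst ij + snd ij) * d) = (\<Sum>ij\<in>J. \<mu> * K)"
      using le by (simp add: e_def flip: sum.distrib)
    moreover have "2 * (\<Sum>ij\<in>J. (fst ij + snd ij) * d) = d * (K * (D + 2))"
      using sum_exponents[of D]
      by (simp add: J_def K case_prod_unfold mult_ac flip: sum_distrib_left sum_distrib_right)
    ultimately show ?thesis by (simp add: cardJ)
  qed
  have sum_M: "2 * (\<Sum>k<K. \<mu> * (K - k)) = \<mu> * (K * (K + 1))"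
  proof -
    have "(\<Sum>k<K. K - k) = (\<Sum>k<K. Suc k)"
      using sum.nat_diff_reindex[of "\<lambda>k. Suc k" K] by (simp add: Suc_diff_Suc cong: sum.cong_simp)
    moreover have "2 * (\<Sum>k<n. Suc k) = n * (n + 1)" for n by (induction n) auto
    ultimately have "2 * (\<Sum>k<K. K - k) = K * (K + 1)" by simp
    then have "\<mu> * (2 * (\<Sum>k<K. K - k)) = \<mu> * (K * (K + 1))" by (rule arg_cong)
    then show ?thesis by (simp only: sum_distrib_left mult.left_commute)
  qed
  \<comment> \<open>Twice the number of free coefficients is
    \<open>K * (2 * \<mu> * K - d * (D + 2))\<close>, twice the number of conditions is
    \<open>\<mu> * K * (K + 1)\<close>. The first is larger exactly when
    \<open>d * (D + 2) < \<mu> * (K - 1)\<close>, and \<open>K - 1 = 3 * D + 2\<close>.\<close>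
  have "(\<Sum>k<K. \<mu> * (K - k)) < (\<Sum>ij\<in>J. e ij)"
  proof -
    have "d * (D + 2) * K < \<mu> * (3 * D + 2) * K"
      using m by (intro mult_strict_right_mono) (simp_all add: \<mu>_def K)
    then have "\<mu> * (K * (K + 1)) + d * (K * (D + 2)) < 2 * (K * (\<mu> * K))"
      unfolding K by (simp add: algebra_simps)
    then show ?thesis using sum_e sum_M by linarith
  qed
  then have "(\<Sum>k<K. degree (P ^ (m * (K - k)))) < (\<Sum>ij\<in>J. e ij)"
    by (simp only: degPK)
  then have "\<exists>c. (\<forall>ij\<in>J. c ij \<in> polys_below (e ij)) \<and> (\<exists>ij\<in>J. c ij \<noteq> 0) \<and>
      (\<forall>k\<in>{..<K}. P ^ (m * (K - k)) dvd (\<Sum>ij\<in>J. coeff (\<xi> ^ fst ij * \<eta> ^ snd ij) k * c ij))"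
    using P by (intro small_solution_congruences) (auto simp: J_def)
  then obtain c where c: "\<And>ij. ij \<in> J \<Longrightarrow> c ij \<in> polys_below (e ij)" and c0: "\<exists>ij\<in>J. c ij \<noteq> 0"
    and cdvd: "\<And>k. k < K \<Longrightarrow>
      P ^ (m * (K - k)) dvd (\<Sum>ij\<in>J. coeff (\<xi> ^ fst ij * \<eta> ^ snd ij) k * c ij)"
    by blast
  have "(\<Sum>ij\<in>J. c ij * (x ^ fst ij * y ^ snd ij)) = 0" if xy: "(x, y) \<in> T" for x y
  proof -
    let ?u = "u x y" and ?N = "P ^ (m * K)"
    \<comment> \<open>Inserting the parametrizations of \<open>x\<close> and \<open>y\<close> makes
      the combination, modulo \<open>P ^ (m * K)\<close>, a polynomial in the local
      parameter.\<close>
    define \<Psi> where "\<Psi> = (\<Sum>ij\<in>J. smult (c ij) (\<xi> ^ fst ij * \<eta> ^ snd ij))"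
    have "[(\<Sum>ij\<in>J. c ij * (x ^ fst ij * y ^ snd ij)) =
        (\<Sum>ij\<in>J. c ij * (poly \<xi> ?u ^ fst ij * poly \<eta> ?u ^ snd ij))] (mod ?N)"
      using \<xi>[OF xy] \<eta>[OF xy]
      by (intro cong_sum cong_mult cong_pow cong_refl) (simp_all add: cong_iff_dvd_diff)
    also have "(\<Sum>ij\<in>J. c ij * (poly \<xi> ?u ^ fst ij * poly \<eta> ?u ^ snd ij)) = poly \<Psi> ?u"
      by (simp add: \<Psi>_def poly_sum)
    also have "poly \<Psi> ?u = (\<Sum>k\<le>degree \<Psi>. coeff \<Psi> k * ?u ^ k)" by (rule poly_altdef)
    finally have cong: "[(\<Sum>ij\<in>J. c ij * (x ^ fst ij * y ^ snd ij)) =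
      (\<Sum>k\<le>degree \<Psi>. coeff \<Psi> k * ?u ^ k)] (mod ?N)" .
    have "?N dvd coeff \<Psi> k * ?u ^ k" for k
    proof -
      have uk: "P ^ (m * k) dvd ?u ^ k" using dvd_power_same[OF u[OF xy]] by (simp add: power_mult)
      show ?thesis
      proof (cases "k < K")
        case True
        have "coeff \<Psi> k = (\<Sum>ij\<in>J. coeff (\<xi> ^ fst ij * \<eta> ^ snd ij) k * c ij)"
          by (simp add: \<Psi>_def coeff_sum mult.commute)
        then have "P ^ (m * (K - k)) * P ^ (m * k) dvd coeff \<Psi> k * ?u ^ k"
          using cdvd[OF True] uk by (intro mult_dvd_mono) simp_all
        moreover have "P ^ (m * (K - k)) * P ^ (m * k) = ?N"
          using True by (simp flip: power_add distrib_left)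
        ultimately show ?thesis by simp
      next
        case False
        then have "?N dvd P ^ (m * k)" by (intro le_imp_power_dvd) simp
        then show ?thesis using uk by (auto intro: dvd_trans)
      qed
    qed
    then have "?N dvd (\<Sum>k\<le>degree \<Psi>. coeff \<Psi> k * ?u ^ k)" by (intro dvd_sum)
    then have "?N dvd (\<Sum>ij\<in>J. c ij * (x ^ fst ij * y ^ snd ij))"
      using cong_dvd_iff[OF cong] by simp
    moreover have "(\<Sum>ij\<in>J. c ij * (x ^ fst ij * y ^ snd ij)) \<in> polys_below (degree ?N)"
    proof (rule polys_below_sum)
      fix ij assume ij: "ij \<in> J"
      have "degree (x ^ fst ij * y ^ snd ij) \<le> degree x * fst ij + degree y * snd ij"
        using degree_mult_le[of "x ^ fst ij" "y ^ snd ij"] degree_power_le[of x "fst ij"]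
          degree_power_le[of y "snd ij"] by linarith
      also have "\<dots> \<le> d * fst ij + d * snd ij"
        using deg[OF xy] by (intro add_mono mult_right_mono) auto
      finally have "degree (x ^ fst ij * y ^ snd ij) \<le> (fst ij + snd ij) * d"
        by (simp add: algebra_simps)
      from polys_below_mult[OF c[OF ij] this]
      show "c ij * (x ^ fst ij * y ^ snd ij) \<in> polys_below (degree ?N)"
        using le[OF ij] by (simp add: e_def degPK)
    qed
    ultimately show ?thesis by (rule dvd_polys_below_imp_0)
  qed
  then show ?thesis
    using c0 by (intro exI[of _ "\<lambda>i j. c (i, j)"]) (auto simp: J_def case_prod_unfold)
qed

subsection \<open>Counting points\<close>

lemma card_le_card_fibres:
  assumes "finite Z" "f ` T \<subseteq> Z"
    and fib: "\<And>z. finite {p \<in> T. f p = z} \<and> card {p \<in> T. f p = z} \<le> N"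
  shows "finite T \<and> card T \<le> N * card Z"
proof -
  have T: "T = (\<Union>z\<in>Z. {p \<in> T. f p = z})" using assms(2) by auto
  have "finite (\<Union>z\<in>Z. {p \<in> T. f p = z})" using assms(1) fib by blast
  moreover have "card (\<Union>z\<in>Z. {p \<in> T. f p = z}) \<le> (\<Sum>z\<in>Z. card {p \<in> T. f p = z})"
    by (rule card_UN_le) fact
  moreover have "\<dots> \<le> (\<Sum>z\<in>Z. N)" using fib by (intro sum_mono) auto
  ultimately show ?thesis using T by (simp add: mult.commute)
qed

lemma mod_mem_polys_below:
  fixes M :: "'a::field poly"
  assumes "M \<noteq> 0" shows "p mod M \<in> polys_below (degree M)"
  using degree_mod_less[OF assms, of p] by (auto simp: polys_below_iff)

text \<open>A partial derivative prime to \<open>P\<close> makes the other coordinate a local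
  parameter. Only the parameter has to be fixed modulo \<open>P ^ m\<close>, the dependent
  coordinate just modulo \<open>P\<close>.\<close>

lemma card_congruent_points_le:
  fixes T :: "('a::{field,finite} poly \<times> 'a poly) set"
  assumes \<alpha>: "degree \<alpha> = 3" and t: "t \<noteq> 0"
    and curve: "\<And>x y. (x, y) \<in> T \<Longrightarrow> t * y ^ 2 + s * y = poly \<alpha> x"
    and deg: "\<And>x y. (x, y) \<in> T \<Longrightarrow> degree x \<le> d \<and> degree y \<le> d"
    and P: "irreducible P" and m: "d * (D + 2) < m * degree P * (3 * D + 2)"
    and T: "(\<forall>(x, y)\<in>T. \<forall>(x', y')\<in>T. P ^ m dvd x - x' \<and> P dvd y - y' \<and> \<not> P dvd s + 2 * t * y) \<or>
      (\<forall>(x, y)\<in>T. \<forall>(x', y')\<in>T. P dvd x - x' \<and> P ^ m dvd y - y' \<and> \<not> P dvd poly (pderiv \<alpha>) x)"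
  shows "finite T \<and> card T \<le> 12 * D + 14"
proof (cases "T = {}")
  case False
  then obtain x0 y0 where xy0: "(x0, y0) \<in> T" by auto
  have pP: "prime_elem P" using P by (rule field_poly_irreducible_imp_prime)
  then have P0: "P \<noteq> 0" by auto
  let ?K = "3 * (D + 1)" and ?\<beta> = "[:0, s, t:]"
  have \<beta>: "poly ?\<beta> y = poly \<alpha> x" if "(x, y) \<in> T" for x y
    using curve[OF that] by (simp add: algebra_simps power2_eq_square)
  have "\<exists>c. (\<exists>i\<le>2. \<exists>j\<le>D. c i j \<noteq> 0) \<and>
    (\<forall>(x, y)\<in>T. (\<Sum>(i, j)\<in>{..2::nat} \<times> {..D}. c i j * (x ^ i * y ^ j)) = 0)"
    using T
  proof
    assume *: "\<forall>(x, y)\<in>T. \<forall>(x', y')\<in>T. P ^ m dvd x - x' \<and> P dvd y - y' \<and> \<not> P dvd s + 2 * t * y"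
    have "\<exists>\<phi>. \<forall>(x, y)\<in>T. P ^ (m * ?K) dvd y - poly \<phi> (x - x0)"
    proof (rule local_parametrization[OF pP])
      show "\<not> P dvd poly (pderiv ?\<beta>) y0"
        using * xy0 by (force simp: pderiv_pCons algebra_simps)
      show "poly ?\<beta> y0 = poly \<alpha> x0" by (rule \<beta>[OF xy0])
      show "poly ?\<beta> y = poly \<alpha> x \<and> P ^ m dvd x - x0 \<and> P dvd y - y0" if "(x, y) \<in> T" for x y
        using * \<beta>[OF that] that xy0 by fast
    qed
    then obtain \<phi> where "\<And>x y. (x, y) \<in> T \<Longrightarrow> P ^ (m * ?K) dvd y - poly \<phi> (x - x0)" by blast
    moreover have "P ^ m dvd x - x0" if "(x, y) \<in> T" for x y using * that xy0 by fast
    ultimately show ?thesis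
      by (intro auxiliary_polynomial[OF P0 m refl deg, where u = "\<lambda>x y. x - x0" and \<xi> = "[:x0, 1:]" and \<eta> = \<phi>])
        auto
  next
    assume *: "\<forall>(x, y)\<in>T. \<forall>(x', y')\<in>T. P dvd x - x' \<and> P ^ m dvd y - y' \<and> \<not> P dvd poly (pderiv \<alpha>) x"
    have "\<exists>\<phi>. \<forall>(y, x)\<in>prod.swap ` T. P ^ (m * ?K) dvd x - poly \<phi> (y - y0)"
    proof (rule local_parametrization[OF pP])
      show "\<not> P dvd poly (pderiv \<alpha>) x0" using * xy0 by fast
      show "poly \<alpha> x0 = poly ?\<beta> y0" using \<beta>[OF xy0] by simp
      show "poly \<alpha> x = poly ?\<beta> y \<and> P ^ m dvd y - y0 \<and> P dvd x - x0"
        if "(y, x) \<in> prod.swap ` T" for y x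
      proof -
        have "(x, y) \<in> T" using that by auto
        then show ?thesis using * \<beta>[of x y] xy0 by fastforce
      qed
    qed
    then obtain \<phi> where "\<And>x y. (x, y) \<in> T \<Longrightarrow> P ^ (m * ?K) dvd x - poly \<phi> (y - y0)" by force
    moreover have "P ^ m dvd y - y0" if "(x, y) \<in> T" for x y using * that xy0 by fast
    ultimately show ?thesis
      by (intro auxiliary_polynomial[OF P0 m refl deg, where u = "\<lambda>x y. y - y0" and \<xi> = \<phi> and \<eta> = "[:y0, 1:]"])
        auto
  qed
  then obtain c where "\<exists>i\<le>2. \<exists>j\<le>D. c i j \<noteq> 0"
    "\<And>x y. (x, y) \<in> T \<Longrightarrow> (\<Sum>(i, j)\<in>{..2::nat} \<times> {..D}. c i j * (x ^ i * y ^ j)) = 0"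
    by blast
  then show ?thesis by (intro card_curve_points_le[OF \<alpha> t _ curve])
qed simp

text \<open>The points are sorted by residues modulo \<open>P ^ m\<close> in one coordinate and
  modulo \<open>P\<close> in the other, once for each partial derivative, hence the factor
  2.\<close>

lemma card_points_smooth_mod_prime_le:
  fixes T :: "('a::{field,finite} poly \<times> 'a poly) set"
  assumes \<alpha>: "degree \<alpha> = 3" and t: "t \<noteq> 0"
    and curve: "\<And>x y. (x, y) \<in> T \<Longrightarrow> t * y ^ 2 + s * y = poly \<alpha> x"
    and deg: "\<And>x y. (x, y) \<in> T \<Longrightarrow> degree x \<le> d \<and> degree y \<le> d"
    and P: "irreducible P" "degree P \<le> k"
    and smooth: "\<And>x y. (x, y) \<in> T \<Longrightarrow> \<not> P dvd s + 2 * t * y \<or> \<not> P dvd poly (pderiv \<alpha>) x"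
  shows "finite T \<and> card T \<le> 2 * (12 * D + 14) * CARD('a) ^ (d * (D + 2) div (3 * D + 2) + 2 * k)"
proof -
  define r where "r = degree P"
  define w where "w = d * (D + 2) div (3 * D + 2)"
  \<comment> \<open>The least \<open>m\<close> with \<open>m * r > w\<close>; rounding up and the
    residue modulo \<open>P\<close> each cost at most \<open>r \<le> k\<close> in the
    exponent.\<close>
  define m where "m = w div r + 1"
  have P0: "P \<noteq> 0" using P by auto
  have r: "r > 0" using P P0 by (auto simp: r_def irreducible_def is_unit_iff_degree)
  have "w < m * r" using r by (simp add: m_def dividend_less_div_times add.commute)
  have mr: "m * r \<le> w + r" by (simp add: m_def)
  have "d * (D + 2) < (w + 1) * (3 * D + 2)"
    using dividend_less_div_times[of "3 * D + 2" "d * (D + 2)"] by (simp add: w_def)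
  also have "\<dots> \<le> m * degree P * (3 * D + 2)"
    using \<open>w < m * r\<close> by (intro mult_right_mono) (simp_all add: r_def)
  finally have m: "d * (D + 2) < m * degree P * (3 * D + 2)" .
  have CARD: "CARD('a) > 0" by simp
  have bound: "CARD('a) ^ (m * r + r) \<le> CARD('a) ^ (w + 2 * k)"
    using mr P(2) CARD by (intro power_increasing) (auto simp: r_def)
  define Ta where "Ta = {(x, y) \<in> T. \<not> P dvd s + 2 * t * y}"
  define Tb where "Tb = {(x, y) \<in> T. \<not> P dvd poly (pderiv \<alpha>) x}"
  have "finite Ta \<and> card Ta \<le> (12 * D + 14) * card (polys_below (m * r) \<times> polys_below r :: ('a poly \<times> 'a poly) set)"
  proof (rule card_le_card_fibres[where f = "\<lambda>(x, y). (x mod P ^ m, y mod P)"])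
    show "(\<lambda>(x, y). (x mod P ^ m, y mod P)) ` Ta \<subseteq> polys_below (m * r) \<times> polys_below r"
      using mod_mem_polys_below[of "P ^ m"] mod_mem_polys_below[of P] P0
      by (auto simp: degree_power_eq r_def mult.commute)
    show "finite {p \<in> Ta. (case p of (x, y) \<Rightarrow> (x mod P ^ m, y mod P)) = z} \<and>
        card {p \<in> Ta. (case p of (x, y) \<Rightarrow> (x mod P ^ m, y mod P)) = z} \<le> 12 * D + 14" for z
      by (rule card_congruent_points_le[OF \<alpha> t _ _ P(1) m], (use curve deg in \<open>auto simp: Ta_def\<close>)[2],
        rule disjI1, auto simp: Ta_def simp flip: mod_eq_dvd_iff)
  qed simp
  then have Ta: "finite Ta \<and> card Ta \<le> (12 * D + 14) * CARD('a) ^ (m * r + r)"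
    by (simp add: card_cartesian_product power_add)
  have "finite Tb \<and> card Tb \<le> (12 * D + 14) * card (polys_below r \<times> polys_below (m * r) :: ('a poly \<times> 'a poly) set)"
  proof (rule card_le_card_fibres[where f = "\<lambda>(x, y). (x mod P, y mod P ^ m)"])
    show "(\<lambda>(x, y). (x mod P, y mod P ^ m)) ` Tb \<subseteq> polys_below r \<times> polys_below (m * r)"
      using mod_mem_polys_below[of "P ^ m"] mod_mem_polys_below[of P] P0
      by (auto simp: degree_power_eq r_def mult.commute)
    show "finite {p \<in> Tb. (case p of (x, y) \<Rightarrow> (x mod P, y mod P ^ m)) = z} \<and>
        card {p \<in> Tb. (case p of (x, y) \<Rightarrow> (x mod P, y mod P ^ m)) = z} \<le> 12 * D + 14" for z
      by (rule card_congruent_points_le[OF \<alpha> t _ _ P(1) m], (use curve deg in \<open>auto simp: Tb_def\<close>)[2],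
        rule disjI2, auto simp: Tb_def simp flip: mod_eq_dvd_iff)
  qed simp
  then have Tb: "finite Tb \<and> card Tb \<le> (12 * D + 14) * CARD('a) ^ (m * r + r)"
    by (simp add: card_cartesian_product power_add mult.commute)
  have "T = Ta \<union> Tb" using smooth by (auto simp: Ta_def Tb_def)
  then have "finite T" and "card T \<le> card Ta + card Tb"
    using Ta Tb card_Un_le by auto
  moreover have "(12 * D + 14) * CARD('a) ^ (m * r + r) \<le> (12 * D + 14) * CARD('a) ^ (w + 2 * k)"
    using bound by (rule mult_left_mono) simp
  ultimately show ?thesis using Ta Tb unfolding w_def by linarith
qed

text \<open>If \<open>pderiv \<alpha> \<noteq> 0\<close>, its at most two roots carry at most two
  points each. Otherwise the characteristic is 3, so 2 is invertible,
  \<open>s + 2 * t * y = 0\<close> fixes \<open>y\<close>, and at most three \<open>x\<close>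
  remain.\<close>

lemma card_singular_points_le:
  fixes T :: "('a::field poly \<times> 'a poly) set"
  assumes \<alpha>: "degree \<alpha> = 3" and t: "t \<noteq> 0"
    and curve: "\<And>x y. (x, y) \<in> T \<Longrightarrow> t * y ^ 2 + s * y = poly \<alpha> x"
    and sing: "\<And>x y. (x, y) \<in> T \<Longrightarrow> s + 2 * t * y = 0 \<and> poly (pderiv \<alpha>) x = 0"
  shows "finite T \<and> card T \<le> 4"
proof (cases "pderiv \<alpha> = 0")
  case False
  have "finite T \<and> card T \<le> 2 * degree (pderiv \<alpha>)"
    by (rule card_curve_points_le_roots[OF False t, of T s \<alpha>]) (use curve sing in auto)
  moreover have "degree (pderiv \<alpha>) \<le> 2"
    using \<alpha> by (intro degree_le) (auto simp: coeff_pderiv coeff_eq_0)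
  ultimately show ?thesis by linarith
next
  case True
  have "coeff \<alpha> 3 \<noteq> 0" using \<alpha> by (metis leading_coeff_0_iff degree_0 zero_neq_numeral)
  moreover have "coeff (pderiv \<alpha>) 2 = 0" by (simp add: True)
  then have "3 * coeff \<alpha> 3 = 0" by (simp add: coeff_pderiv eval_nat_numeral)
  ultimately have three: "(3 :: 'a poly) = 0" by simp
  have two: "(2 :: 'a poly) \<noteq> 0"
  proof
    assume "(2 :: 'a poly) = 0"
    then have "(3 :: 'a poly) - 2 = 0" using three by simp
    then show False by simp
  qed
  show ?thesis
  proof (cases "T = {}")
    case False
    then obtain x0 y0 where xy0: "(x0, y0) \<in> T" by auto
    have y: "y = y0" if "(x, y) \<in> T" for x y
    proof -
      have "s + 2 * t * y = s + 2 * t * y0" using sing[OF that] sing[OF xy0] by simp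
      then have "2 * t * (y - y0) = 0" by (simp add: algebra_simps)
      then show ?thesis using two t by simp
    qed
    define R where "R = \<alpha> - [:t * y0 ^ 2 + s * y0:]"
    have "degree R = 3"
      unfolding R_def diff_conv_add_uminus by (subst degree_add_eq_left) (simp_all add: \<alpha>)
    then have "R \<noteq> 0" by auto
    have sub: "T \<subseteq> {x. poly R x = 0} \<times> {y0}"
      using y curve by (auto simp: R_def)
    have fin: "finite {x. poly R x = 0}" by (rule poly_roots_finite) fact
    then have "card T \<le> card ({x. poly R x = 0} \<times> {y0})" using sub by (intro card_mono) auto
    also have "\<dots> \<le> 3"
      using card_poly_roots_bound[OF \<open>R \<noteq> 0\<close>] \<open>degree R = 3\<close> by (simp add: card_cartesian_product)
    finally show ?thesis using fin sub by (auto intro: finite_subset)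
  qed simp
qed

text \<open>The partial derivatives at a point have degree below \<open>2 ^ k\<close>, so a
  nonsingular point stays nonsingular modulo some irreducible \<open>P\<close> of degree at most
  \<open>k\<close>. Summing over at most \<open>CARD('a) ^ (k + 1)\<close> such \<open>P\<close>
  raises the exponent from \<open>2 * k\<close> to \<open>3 * k + 1\<close>.\<close>

lemma card_points_small_curve_le:
  fixes T :: "('a::{field,finite} poly \<times> 'a poly) set"
  assumes \<alpha>: "degree \<alpha> = 3" and t: "t \<noteq> 0"
    and curve: "\<And>x y. (x, y) \<in> T \<Longrightarrow> t * y ^ 2 + s * y = poly \<alpha> x"
    and deg: "\<And>x y. (x, y) \<in> T \<Longrightarrow> degree x \<le> d \<and> degree y \<le> d"
    and coeffs: "\<And>i. degree (coeff \<alpha> i) \<le> e" "degree s \<le> e" "degree t \<le> e"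
    and k: "e + 2 * d < 2 ^ k" "k > 0"
  shows "card T \<le> 4 + 2 * (12 * D + 14) * CARD('a) ^ (d * (D + 2) div (3 * D + 2) + 3 * k + 1)"
proof -
  define w where "w = d * (D + 2) div (3 * D + 2)"
  define \<P> where "\<P> = {P :: 'a poly. irreducible P \<and> degree P \<le> k}"
  define T0 where "T0 = {(x, y) \<in> T. s + 2 * t * y = 0 \<and> poly (pderiv \<alpha>) x = 0}"
  define TP where "TP P = {(x, y) \<in> T. \<not> P dvd s + 2 * t * y \<or> \<not> P dvd poly (pderiv \<alpha>) x}" for P
  have sub\<P>: "\<P> \<subseteq> polys_below (Suc k)" by (auto simp: \<P>_def polys_below_Suc_iff)
  have fin\<P>: "finite \<P>" using sub\<P> by (rule finite_subset) simp
  have card\<P>: "card \<P> \<le> CARD('a) ^ Suc k" using card_mono[OF _ sub\<P>] by simp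
  have T0: "finite T0 \<and> card T0 \<le> 4"
    by (rule card_singular_points_le[OF \<alpha> t]) (use curve in \<open>auto simp: T0_def\<close>)
  have TP: "finite (TP P) \<and> card (TP P) \<le> 2 * (12 * D + 14) * CARD('a) ^ (w + 2 * k)" if "P \<in> \<P>" for P
    unfolding w_def
    by (rule card_points_smooth_mod_prime_le[OF \<alpha> t, of _ s]) (use that curve deg in \<open>auto simp: TP_def \<P>_def\<close>)
  have deg1: "degree (s + 2 * t * y) < 2 ^ k" if "(x, y) \<in> T" for x y
  proof -
    have "degree (2 * t * y) \<le> e + d"
      using degree_mult_le[of "2 * t" y] degree_mult_le[of 2 t] coeffs(3) deg[OF that] by simp
    then have "degree (s + 2 * t * y) \<le> e + 2 * d" using coeffs(2) by (intro degree_add_le) auto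
    then show ?thesis using k by simp
  qed
  have deg2: "degree (poly (pderiv \<alpha>) x) < 2 ^ k" if "(x, y) \<in> T" for x y
  proof -
    have "degree (poly (pderiv \<alpha>) x) \<le> e + 2 * d"
      unfolding poly_altdef
    proof (rule degree_sum_le)
      fix i assume "i \<in> {..degree (pderiv \<alpha>)}"
      moreover have "degree (pderiv \<alpha>) \<le> 2"
        using \<alpha> by (intro degree_le) (auto simp: coeff_pderiv coeff_eq_0)
      ultimately have "i \<le> 2" by simp
      have "degree (coeff (pderiv \<alpha>) i) \<le> e"
        unfolding coeff_pderiv
        using degree_mult_le[of "of_nat (Suc i)" "coeff \<alpha> (Suc i)"] coeffs(1)[of "Suc i"]
        by (simp only: degree_of_nat)
      moreover have "degree x * i \<le> d * 2" using deg[OF that] \<open>i \<le> 2\<close> by (intro mult_mono) auto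
      then have "degree (x ^ i) \<le> 2 * d" using degree_power_le[of x i] by linarith
      ultimately show "degree (coeff (pderiv \<alpha>) i * x ^ i) \<le> e + 2 * d"
        using degree_mult_le[of "coeff (pderiv \<alpha>) i" "x ^ i"] by linarith
    qed simp
    then show ?thesis using k by simp
  qed
  have "T \<subseteq> T0 \<union> (\<Union>P\<in>\<P>. TP P)"
  proof
    fix z assume "z \<in> T"
    then obtain x y where z: "z = (x, y)" "(x, y) \<in> T" by (cases z) auto
    show "z \<in> T0 \<union> (\<Union>P\<in>\<P>. TP P)"
    proof (cases "s + 2 * t * y = 0 \<and> poly (pderiv \<alpha>) x = 0")
      case True
      then show ?thesis using z by (simp add: T0_def)
    next
      case False
      then have "\<exists>P\<in>\<P>. \<not> P dvd s + 2 * t * y \<or> \<not> P dvd poly (pderiv \<alpha>) x"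
        using irreducible_not_dvd_exists[of "s + 2 * t * y" k]
          irreducible_not_dvd_exists[of "poly (pderiv \<alpha>) x" k] deg1[OF z(2)] deg2[OF z(2)] k(2)
        unfolding \<P>_def by blast
      then show ?thesis using z by (auto simp: TP_def)
    qed
  qed
  moreover have "finite (T0 \<union> (\<Union>P\<in>\<P>. TP P))" using T0 TP fin\<P> by auto
  ultimately have "card T \<le> card (T0 \<union> (\<Union>P\<in>\<P>. TP P))" by (rule card_mono[rotated])
  also have "\<dots> \<le> card T0 + card (\<Union>P\<in>\<P>. TP P)" by (rule card_Un_le)
  also have "card (\<Union>P\<in>\<P>. TP P) \<le> (\<Sum>P\<in>\<P>. card (TP P))" by (rule card_UN_le) fact
  also have "\<dots> \<le> (\<Sum>P\<in>\<P>. 2 * (12 * D + 14) * CARD('a) ^ (w + 2 * k))"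
    using TP by (intro sum_mono) auto
  also have "\<dots> = card \<P> * (2 * (12 * D + 14) * CARD('a) ^ (w + 2 * k))" by simp
  also have "\<dots> \<le> CARD('a) ^ Suc k * (2 * (12 * D + 14) * CARD('a) ^ (w + 2 * k))"
    using card\<P> by (rule mult_right_mono) simp
  also have "\<dots> = 2 * (12 * D + 14) * (CARD('a) ^ Suc k * CARD('a) ^ (w + 2 * k))"
    by (simp only: ac_simps)
  also have "CARD('a) ^ Suc k * CARD('a) ^ (w + 2 * k) = CARD('a) ^ (w + 3 * k + 1)"
  proof -
    have "w + 3 * k + 1 = Suc k + (w + 2 * k)" by simp
    then show ?thesis by (simp only: power_add)
  qed
  finally show ?thesis using T0 by (simp add: w_def)
qed

text \<open>Coefficients of degree at most \<open>15 * d\<close> account for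
  \<open>17 * d = 15 * d + 2 * d\<close>, and 42 = 38 + 4 covers both the case of few points and the
  singular points.\<close>

lemma num_solutions_le:
  fixes f lam X0 :: "'a::{field,finite} poly"
  assumes f: "irreducible f" and lam: "\<not> f dvd lam" and d: "9 * d < degree f"
    and k: "17 * d < 2 ^ k" "k > 0"
  shows "num_solutions f lam (poly_interval X0 d) \<le>
    42 + 2 * (12 * D + 14) * CARD('a) ^ (d * (D + 2) div (3 * D + 2) + 3 * k + 1)"
proof -
  define T where "T = {(x, y). degree x \<le> d \<and> degree y \<le> d \<and> [(X0 + x) ^ 3 = lam * (X0 + y) ^ 2] (mod f)}"
  have "{(a, b). a \<in> poly_interval X0 d \<and> b \<in> poly_interval X0 d \<and> [a ^ 3 = lam * b ^ 2] (mod f)}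
      = (\<lambda>(x, y). (X0 + x, X0 + y)) ` T"
    by (auto simp: T_def poly_interval_def)
  moreover have "inj_on (\<lambda>(x, y). (X0 + x, X0 + y)) T" by (auto simp: inj_on_def)
  ultimately have num: "num_solutions f lam (poly_interval X0 d) = card T"
    by (simp add: num_solutions_def card_image)
  obtain \<alpha> s t where \<alpha>: "degree \<alpha> = 3" "t \<noteq> 0"
    and curve: "\<And>x y. \<lbrakk>degree x \<le> d; degree y \<le> d; [(X0 + x) ^ 3 = lam * (X0 + y) ^ 2] (mod f)\<rbrakk> \<Longrightarrow>
      t * y ^ 2 + s * y = poly \<alpha> x"
    using lattice_curve[OF f lam d, of X0] by metis
  have deg: "degree x \<le> d \<and> degree y \<le> d" if "(x, y) \<in> T" for x y
    using that by (simp add: T_def)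
  have "card T \<le> 38 \<or>
    (\<exists>\<alpha>' s' t'. degree \<alpha>' = 3 \<and> t' \<noteq> 0 \<and> (\<forall>i. degree (coeff \<alpha>' i) \<le> 15 * d) \<and>
      degree s' \<le> 15 * d \<and> degree t' \<le> 15 * d \<and>
      (\<forall>(x, y)\<in>T. t' * y ^ 2 + s' * y = poly \<alpha>' x))"
    by (rule small_curve[OF \<alpha> _ deg]) (use curve in \<open>auto simp: T_def\<close>)
  then show ?thesis
  proof (elim disjE exE conjE)
    fix \<alpha>' s' t'
    assume *: "degree \<alpha>' = 3" "t' \<noteq> 0" "\<forall>i. degree (coeff \<alpha>' i) \<le> 15 * d" "degree s' \<le> 15 * d"
      "degree t' \<le> 15 * d" "\<forall>(x, y)\<in>T. t' * y ^ 2 + s' * y = poly \<alpha>' x"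
    have "card T \<le> 4 + 2 * (12 * D + 14) * CARD('a) ^ (d * (D + 2) div (3 * D + 2) + 3 * k + 1)"
      by (rule card_points_small_curve_le[OF *(1,2) _ deg, where s = s' and e = "15 * d"]) (use * k in auto)
    then show ?thesis by (simp add: num)
  qed (simp add: num)
qed

subsection \<open>The exponent\<close>

text \<open>Converts a bound for every \<delta> and all large \<open>N\<close> into a single o(1)
  term: \<epsilon> is read off from the largest admissible \<open>s\<close>, which exists because of
  \<open>b\<close>.\<close>

lemma exponent_sequence:
  fixes Q :: "nat \<Rightarrow> nat \<Rightarrow> bool" and a :: real
  assumes bound: "\<And>\<delta>. \<delta> > 0 \<Longrightarrow> \<exists>N0. \<forall>N\<ge>N0. \<forall>s. Q N s \<longrightarrow> real s \<le> real N powr (a + \<delta>)"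
    and Q: "\<And>N s. Q N s \<Longrightarrow> 2 \<le> N \<and> s \<le> b N" and "a \<ge> 0"
  shows "\<exists>\<epsilon>. \<epsilon> \<longlonglongrightarrow> 0 \<and> (\<forall>N s. Q N s \<longrightarrow> real s \<le> real N powr (a + \<epsilon> N))"
proof -
  define M where "M N = Max (insert 0 {s. Q N s})" for N
  \<comment> \<open>Below 2 there is no usable base for the logarithm, hence the default 0;
    \<open>max 0\<close> handles sizes whose exponent is below \<open>a\<close>.\<close>
  define \<epsilon> where "\<epsilon> N = (if N < 2 then 0 else max 0 (log (real N) (real (M N)) - a))" for N
  have fin: "finite (insert 0 {s. Q N s})" for N
  proof (rule finite_subset)
    show "insert 0 {s. Q N s} \<subseteq> insert 0 {..b N}" using Q by blast
  qed simp
  have M_ge: "s \<le> M N" if "Q N s" for N s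
    unfolding M_def using that by (intro Max_ge fin) auto
  have M_mem: "M N = 0 \<or> Q N (M N)" for N
    using Max_in[OF fin, of N] unfolding M_def by blast
  have "\<epsilon> \<longlonglongrightarrow> 0"
  proof (rule LIMSEQ_I)
    fix r :: real assume "r > 0"
    then obtain N0 where N0: "\<And>N s. N \<ge> N0 \<Longrightarrow> Q N s \<Longrightarrow> real s \<le> real N powr (a + r / 2)"
      using bound[of "r / 2"] by (meson half_gt_zero)
    have "norm (\<epsilon> N - 0) < r" if "N \<ge> N0" for N
    proof (cases "N < 2 \<or> M N = 0")
      case True
      then show ?thesis using \<open>r > 0\<close> \<open>a \<ge> 0\<close> by (auto simp: \<epsilon>_def log_def)
    next
      case False
      with M_mem[of N] have "Q N (M N)" by simp
      then have "real (M N) \<le> real N powr (a + r / 2)" by (rule N0[OF that])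
      then have "log (real N) (real (M N)) \<le> log (real N) (real N powr (a + r / 2))"
        using False by (subst log_le_cancel_iff) auto
      then show ?thesis using False \<open>r > 0\<close> by (simp add: \<epsilon>_def)
    qed
    then show "\<exists>N0. \<forall>N\<ge>N0. norm (\<epsilon> N - 0) < r" by blast
  qed
  moreover have "real s \<le> real N powr (a + \<epsilon> N)" if "Q N s" for N s
  proof (cases "s = 0")
    case False
    have N: "2 \<le> N" using Q[OF that] by simp
    have "real s \<le> real (M N)" using M_ge[OF that] by simp
    also have "\<dots> = real N powr log (real N) (real (M N))"
      using N False M_ge[OF that] by (subst powr_log_cancel) auto
    also have "\<dots> \<le> real N powr (a + \<epsilon> N)"
      using N by (intro powr_mono) (auto simp: \<epsilon>_def)
    finally show ?thesis .
  qed simp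
  ultimately show ?thesis by blast
qed

text \<open>Since (D + 2) / (3 D + 2) = 1/3 + 4 / (9 D + 6), a large \<open>D\<close> costs at most
  half of \<delta>; the other half absorbs the constant and \<open>3 * k + 1\<close>, which is
  logarithmic in \<open>d\<close>.\<close>

lemma eventually_bound_le_powr:
  fixes q :: nat and \<delta> :: real
  assumes q: "q \<ge> 2" and "\<delta> > 0"
  shows "\<exists>D d0. \<forall>d\<ge>d0. \<exists>k>0. 17 * d < 2 ^ k \<and>
    real (42 + 2 * (12 * D + 14) * q ^ (d * (D + 2) div (3 * D + 2) + 3 * k + 1))
      \<le> real (q ^ Suc d) powr (1 / 3 + \<delta>)"
proof -
  obtain D :: nat where D: "4 / \<delta> < real D" using reals_Archimedean2 by blast
  define C where "C = real (24 * D + 70)"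
  have D': "4 / (9 * real D + 6) \<le> \<delta> / 2"
  proof -
    have "4 < \<delta> * real D" using D \<open>\<delta> > 0\<close> by (simp add: field_simps)
    then have "8 \<le> \<delta> * (9 * real D + 6)" using \<open>\<delta> > 0\<close> by (simp add: algebra_simps)
    then show ?thesis by (simp add: field_simps)
  qed
  have "eventually (\<lambda>d::nat. log (real q) C + 3 * (log 2 (17 * real d + 1) + 2) + 1 \<le> \<delta> / 2 * real d) at_top"
    using \<open>\<delta> > 0\<close> by real_asymp
  then obtain d0 where d0: "\<And>d::nat. d \<ge> d0 \<Longrightarrow>
      log (real q) C + 3 * (log 2 (17 * real d + 1) + 2) + 1 \<le> \<delta> / 2 * real d"
    by (auto simp: eventually_sequentially)
  have "\<exists>k>0. 17 * d < 2 ^ k \<and>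
    real (42 + 2 * (12 * D + 14) * q ^ (d * (D + 2) div (3 * D + 2) + 3 * k + 1))
      \<le> real (q ^ Suc d) powr (1 / 3 + \<delta>)" if d: "d \<ge> d0" for d
  proof -
    define L where "L = log 2 (17 * real d + 1)"
    have "L \<ge> 0" by (simp add: L_def)
    define k where "k = nat \<lceil>L\<rceil> + 1"
    have kL: "L \<le> real k" "real k \<le> L + 2" using \<open>L \<ge> 0\<close> by (simp_all add: k_def) linarith+
    have "17 * real d < 2 powr L" by (simp add: L_def)
    also have "\<dots> \<le> 2 powr real k" using kL by simp
    finally have k: "17 * d < 2 ^ k" by (simp add: powr_realpow flip: of_nat_less_iff[where 'a = real])
    define w where "w = d * (D + 2) div (3 * D + 2)"
    have "w * (3 * D + 2) \<le> d * (D + 2)"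
      unfolding w_def by (rule div_times_less_eq_dividend)
    then have "real (w * (3 * D + 2)) \<le> real (d * (D + 2))" by (simp only: of_nat_le_iff)
    then have w: "real w \<le> real d * (1 / 3 + 4 / (9 * real D + 6))"
      by (simp add: field_simps)
    have "real q > 1" using q by simp
    have "42 + 2 * (12 * D + 14) * q ^ (w + 3 * k + 1) \<le> (24 * D + 70) * q ^ (w + 3 * k + 1)"
      using q by (simp add: algebra_simps)
    then have "real (42 + 2 * (12 * D + 14) * q ^ (w + 3 * k + 1)) \<le> real ((24 * D + 70) * q ^ (w + 3 * k + 1))"
      by (simp only: of_nat_le_iff)
    also have "\<dots> = C * real q ^ (w + 3 * k + 1)" by (simp only: C_def of_nat_mult of_nat_power)
    also have "real q ^ (w + 3 * k + 1) = real q powr real (w + 3 * k + 1)"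
      using \<open>real q > 1\<close> by (subst powr_realpow) simp_all
    also have "C * real q powr real (w + 3 * k + 1) = real q powr (log (real q) C + real (w + 3 * k + 1))"
      using \<open>real q > 1\<close> by (simp add: powr_add C_def)
    also have "\<dots> \<le> real q powr (real (Suc d) * (1 / 3 + \<delta>))"
    proof (rule powr_mono)
      have "log (real q) C + 3 * real k + 1 \<le> \<delta> / 2 * real d" using d0[OF d] kL by (simp add: L_def)
      moreover have "real d * (4 / (9 * real D + 6)) \<le> real d * (\<delta> / 2)"
        using D' by (rule mult_left_mono) simp
      ultimately have "log (real q) C + real (w + 3 * k + 1) \<le> real d * (1 / 3 + \<delta>)"
        using w by (simp add: algebra_simps)
      also have "\<dots> \<le> real (Suc d) * (1 / 3 + \<delta>)" using \<open>\<delta> > 0\<close> by (intro mult_right_mono) auto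
      finally show "log (real q) C + real (w + 3 * k + 1) \<le> real (Suc d) * (1 / 3 + \<delta>)" .
    qed (use \<open>real q > 1\<close> in simp)
    also have "\<dots> = (real q powr real (Suc d)) powr (1 / 3 + \<delta>)" by (simp only: powr_powr)
    also have "real q powr real (Suc d) = real (q ^ Suc d)"
      using \<open>real q > 1\<close> by (subst powr_realpow) simp_all
    finally show ?thesis using k unfolding w_def by (intro exI[of _ k]) (simp add: k_def)
  qed
  then show ?thesis by blast
qed

text \<open>The interval has \<open>CARD('a) ^ (d + 1)\<close> elements, so the hypothesis compares
  \<open>d + 1\<close> with \<open>degree f / 9\<close>.\<close>

lemma degree_ge_if_card_interval_le:
  fixes f :: "'a::{field,finite} poly"
  assumes "irreducible f" "real (card (poly_interval X0 d :: 'a poly set)) \<le> poly_abs f powr (1 / 9)"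
  shows "9 * d < degree f"
proof -
  have "f \<noteq> 0" using assms(1) by auto
  have q: "real CARD('a) > 1"
    using card_mono[of UNIV "{0, 1::'a}"] by simp
  have "real CARD('a) powr real (Suc d) \<le> (real CARD('a) powr real (degree f)) powr (1 / 9)"
    using assms(2) \<open>f \<noteq> 0\<close> q by (simp add: card_poly_interval poly_abs_def powr_realpow del: of_nat_Suc power_Suc)
  also have "\<dots> = real CARD('a) powr (real (degree f) / 9)" by (simp add: powr_powr)
  finally have "real (Suc d) \<le> real (degree f) / 9" using q by (simp only: powr_le_cancel_iff)
  then show ?thesis by simp
qed

text \<open>\<epsilon> is chosen before the interval, \<open>f\<close> and \<open>lam\<close>, so it
  depends only on the field and on \<open>card I\<close>.\<close>

theorem theorem2:
  "\<exists>\<epsilon> :: nat \<Rightarrow> real. \<epsilon> \<longlonglongrightarrow> 0 \<and>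
    (\<forall>(X\<^sub>0 :: 'a::{field,finite} poly) (d :: nat) (f :: 'a poly) (lam :: 'a poly).
      let I = poly_interval X\<^sub>0 d in
        irreducible f \<longrightarrow> 1 \<le> card I \<longrightarrow> real (card I) \<le> poly_abs f powr (1 / 9) \<longrightarrow>
        \<not> f dvd lam \<longrightarrow>
        real (num_solutions f lam I) \<le> real (card I) powr (1 / 3 + \<epsilon> (card I)))"
proof -
  define q where "q = CARD('a)"
  have q: "q \<ge> 2" using card_mono[of UNIV "{0, 1::'a}"] by (simp add: q_def)
  \<comment> \<open>Collects the solution counts of all admissible data with intervals of size
    \<open>N\<close>, for which one exponent has to serve.\<close>
  define Q where "Q N s \<longleftrightarrow> (\<exists>(X0 :: 'a poly) d f lam. N = card (poly_interval X0 d) \<and>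
    s = num_solutions f lam (poly_interval X0 d) \<and> irreducible f \<and> \<not> f dvd lam \<and>
    real N \<le> poly_abs f powr (1 / 9))" for N s
  have "\<exists>\<epsilon>. \<epsilon> \<longlonglongrightarrow> 0 \<and> (\<forall>N s. Q N s \<longrightarrow> real s \<le> real N powr (1 / 3 + \<epsilon> N))"
  proof (rule exponent_sequence)
    fix \<delta> :: real assume "\<delta> > 0"
    from eventually_bound_le_powr[OF q this] obtain D d0 where d0: "\<And>d. d \<ge> d0 \<Longrightarrow> \<exists>k>0. 17 * d < 2 ^ k \<and>
      real (42 + 2 * (12 * D + 14) * q ^ (d * (D + 2) div (3 * D + 2) + 3 * k + 1))
        \<le> real (q ^ Suc d) powr (1 / 3 + \<delta>)"
      by blast
    have "real s \<le> real N powr (1 / 3 + \<delta>)" if N: "N \<ge> q ^ Suc d0" and "Q N s" for N s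
    proof -
      from \<open>Q N s\<close> obtain X0 :: "'a poly" and d f lam where N_eq: "N = card (poly_interval X0 d)"
        and s: "s = num_solutions f lam (poly_interval X0 d)" and f: "irreducible f" "\<not> f dvd lam"
        and le: "real N \<le> poly_abs f powr (1 / 9)"
        unfolding Q_def by blast
      have Nq: "N = q ^ Suc d" by (simp add: N_eq card_poly_interval q_def)
      then have "d \<ge> d0" using N q by (simp only: power_increasing_iff)
      then obtain k where k: "k > 0" "17 * d < 2 ^ k" and
        "real (42 + 2 * (12 * D + 14) * q ^ (d * (D + 2) div (3 * D + 2) + 3 * k + 1)) \<le> real N powr (1 / 3 + \<delta>)"
        using d0 unfolding Nq by blast
      moreover have "s \<le> 42 + 2 * (12 * D + 14) * q ^ (d * (D + 2) div (3 * D + 2) + 3 * k + 1)"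
        unfolding s q_def
        using f k degree_ge_if_card_interval_le[OF f(1) le[unfolded N_eq]] by (intro num_solutions_le)
      ultimately show ?thesis by linarith
    qed
    then show "\<exists>N0. \<forall>N\<ge>N0. \<forall>s. Q N s \<longrightarrow> real s \<le> real N powr (1 / 3 + \<delta>)" by blast
  next
    fix N s assume "Q N s"
    then obtain X0 :: "'a poly" and d f lam where N: "N = card (poly_interval X0 d)"
      and s: "s = num_solutions f lam (poly_interval X0 d)"
      unfolding Q_def by blast
    have "2 \<le> q ^ Suc d" using q self_le_power[of q "Suc d"] by linarith
    moreover have "s \<le> card (poly_interval X0 d \<times> poly_interval X0 d)"
      unfolding s num_solutions_def by (intro card_mono) (auto simp: finite_poly_interval)
    ultimately show "2 \<le> N \<and> s \<le> N * N"
      by (simp add: N card_cartesian_product card_poly_interval q_def)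
  qed simp
  then obtain \<epsilon> where "\<epsilon> \<longlonglongrightarrow> 0" "\<And>N s. Q N s \<Longrightarrow> real s \<le> real N powr (1 / 3 + \<epsilon> N)" by blast
  then show ?thesis
    unfolding Let_def Q_def by (intro exI[of _ \<epsilon>]) blast
qed

end
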